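(* Let $K$ be a Kleene algebra, $n$ a positive integer, and $M$ the Kleene algebra of $n\times n$ matrices over $K$. Then $K$ is Morita-equivalent with $M$ (as Kleene algebras): there exist a Kleene $(K,M)$-bimodule $X$ and a Kleene $(M,K)$-bimodule $Y$ with $X\otimes_M Y\cong {}_KK_K$ and $Y\otimes_K X\cong {}_MM_M$ as bimodules.
   Context: A semiring $\langle S,+,\cdot,0,1\rangle$ is unital: $\langle S,+,0\rangle$ is a commutative monoid, $\langle S,\cdot,1\rangle$ is a monoid, $s0=0s=0$ for all $s$, and multiplication distributes over addition on both sides. A left module over a semiring $S$ is a commutative monoid $\langle M,+,0\rangle$ with a map $S\times M\to M$ satisfying $s(m+n)=sm+sn$, $(s+t)m=sm+tm$, $s(tm)=(st)m$, $1m=m$, $0m=0$; right modules are defined symmetrically. An $(S,T)$-bimodule is a left $S$-module and right $T$-module on the same commutative monoid with $s(mt)=(sm)t$. Homomorphisms are maps preserving addition and the scalar action(s); isomorphisms are invertible homomorphisms. A Kleene algebra is an additively idempotent semiring $K$ ($x+x=x$), ordered by $x\le y\iff x+y=y$, with a unary operation $*$ such that for all $x,y,z$: $1+xx^*=1+x^*x=x^*$; if $x+yz\le z$ then $y^*x\le z$; if $x+zy\le z$ then $xy^*\le z$. A left Kleene module over $K$ is a left module $M$ over the semiring reduct of $K$ such that $am\le m\Rightarrow a^*m\le m$ for all $a\in K$, $m\in M$ (where $x\le y\iff x+y=y$); a right Kleene module is defined symmetrically ($ma\le m\Rightarrow ma^*\le m$). A Kleene $(K,L)$-bimodule is a semiring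 $(K,L)$-bimodule that is both a left Kleene module over $K$ and a right Kleene module over $L$. The $n\times n$ matrices over $K$, with the usual matrix addition and multiplication, form a Kleene algebra under the standard matrix asterate, defined recursively via block decomposition (with $a,d$ square) by $$\begin{pmatrix} a&b\\c&d\end{pmatrix}^*=\begin{pmatrix} f& fbd^*\\ d^*cf& d^*+d^*cfbd^*\end{pmatrix},\qquad f=(a+bd^*c)^*.$$ (The operation $*$ of a Kleene algebra is uniquely determined by its semiring reduct.) Tensor product: for an $(A,B)$-bimodule $X$ and a $(B,C)$-bimodule $Y$, $X\otimes_B Y$ is the quotient of the commutative monoid of finite formal sums of pairs $(x,y)\in X\times Y$ by the least congruence under which the class $x\otimes y$ of $(x,y)$ is additive in each variable (with $0\otimes y=x\otimes 0=0$) and $B$-balanced, $xb\otimes y=x\otimes by$; it is an $(A,C)$-bimodule via $a(x\otimes y)=(ax)\otimes y$ and $(x\otimes y)c=x\otimes(yc)$. ${}_KK_K$ denotes $K$ as a bimodule over itself by multiplication. *)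

theory Defs
  imports "HOL-Library.Multiset" "Jordan_Normal_Form.Matrix"
begin

text \<open>
  Structures are carrier-based. The locale \<^locale>\<open>semiring\<close> of HOL-Algebra is unital and, unlike
  the type class for semirings with one, does not require zero and one to be distinct.
\<close>

definition add_le :: "('a, 'm) ring_scheme \<Rightarrow> 'a \<Rightarrow> 'a \<Rightarrow> bool"
    (\<open>(_ \<preceq>\<index> _)\<close> [51, 51] 50) where
  "x \<preceq>\<^bsub>R\<^esub> y \<longleftrightarrow> x \<oplus>\<^bsub>R\<^esub> y = y"

record 'a kleene_algebra = "'a ring" +
  star :: "'a \<Rightarrow> 'a" (\<open>_\<^sup>\<star>\<index>\<close> [1000] 999)

locale kleene_algebra = semiring K for K (structure) +
  assumes star_closed: "x \<in> carrier K \<Longrightarrow> x\<^sup>\<star> \<in> carrier K"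
    and add_idem: "x \<in> carrier K \<Longrightarrow> x \<oplus> x = x"
    and star_unfold_left: "x \<in> carrier K \<Longrightarrow> \<one> \<oplus> x \<otimes> x\<^sup>\<star> = x\<^sup>\<star>"
    and star_unfold_right: "x \<in> carrier K \<Longrightarrow> \<one> \<oplus> x\<^sup>\<star> \<otimes> x = x\<^sup>\<star>"
    and star_induct_left:
      "\<lbrakk>x \<in> carrier K; y \<in> carrier K; z \<in> carrier K; x \<oplus> y \<otimes> z \<preceq> z\<rbrakk> \<Longrightarrow> y\<^sup>\<star> \<otimes> x \<preceq> z"
    and star_induct_right:
      "\<lbrakk>x \<in> carrier K; y \<in> carrier K; z \<in> carrier K; x \<oplus> z \<otimes> y \<preceq> z\<rbrakk> \<Longrightarrow> x \<otimes> y\<^sup>\<star> \<preceq> z"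

locale left_semimodule = S: semiring S + X: abelian_monoid X
  for S :: "('s, 'p) ring_scheme" and X :: "('x, 'q) ring_scheme"
    and act :: "'s \<Rightarrow> 'x \<Rightarrow> 'x" (infixr \<open>\<lhd>\<close> 75) +
  assumes act_closed: "\<lbrakk>s \<in> carrier S; x \<in> carrier X\<rbrakk> \<Longrightarrow> s \<lhd> x \<in> carrier X"
    and act_add_right: "\<lbrakk>s \<in> carrier S; x \<in> carrier X; y \<in> carrier X\<rbrakk>
      \<Longrightarrow> s \<lhd> (x \<oplus>\<^bsub>X\<^esub> y) = (s \<lhd> x) \<oplus>\<^bsub>X\<^esub> (s \<lhd> y)"
    and act_add_left: "\<lbrakk>s \<in> carrier S; t \<in> carrier S; x \<in> carrier X\<rbrakk>
      \<Longrightarrow> (s \<oplus>\<^bsub>S\<^esub> t) \<lhd> x = (s \<lhd> x) \<oplus>\<^bsub>X\<^esub> (t \<lhd> x)"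
    and act_assoc: "\<lbrakk>s \<in> carrier S; t \<in> carrier S; x \<in> carrier X\<rbrakk>
      \<Longrightarrow> s \<lhd> (t \<lhd> x) = (s \<otimes>\<^bsub>S\<^esub> t) \<lhd> x"
    and act_one: "x \<in> carrier X \<Longrightarrow> \<one>\<^bsub>S\<^esub> \<lhd> x = x"
    and act_zero: "x \<in> carrier X \<Longrightarrow> \<zero>\<^bsub>S\<^esub> \<lhd> x = \<zero>\<^bsub>X\<^esub>"

locale right_semimodule = T: semiring T + X: abelian_monoid X
  for T :: "('t, 'p) ring_scheme" and X :: "('x, 'q) ring_scheme"
    and act :: "'x \<Rightarrow> 't \<Rightarrow> 'x" (infixl \<open>\<rhd>\<close> 75) +
  assumes act_closed: "\<lbrakk>x \<in> carrier X; t \<in> carrier T\<rbrakk> \<Longrightarrow> x \<rhd> t \<in> carrier X"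
    and act_add_left: "\<lbrakk>x \<in> carrier X; y \<in> carrier X; t \<in> carrier T\<rbrakk>
      \<Longrightarrow> (x \<oplus>\<^bsub>X\<^esub> y) \<rhd> t = (x \<rhd> t) \<oplus>\<^bsub>X\<^esub> (y \<rhd> t)"
    and act_add_right: "\<lbrakk>x \<in> carrier X; s \<in> carrier T; t \<in> carrier T\<rbrakk>
      \<Longrightarrow> x \<rhd> (s \<oplus>\<^bsub>T\<^esub> t) = (x \<rhd> s) \<oplus>\<^bsub>X\<^esub> (x \<rhd> t)"
    and act_assoc: "\<lbrakk>x \<in> carrier X; s \<in> carrier T; t \<in> carrier T\<rbrakk>
      \<Longrightarrow> (x \<rhd> s) \<rhd> t = x \<rhd> (s \<otimes>\<^bsub>T\<^esub> t)"
    and act_one: "x \<in> carrier X \<Longrightarrow> x \<rhd> \<one>\<^bsub>T\<^esub> = x"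
    and act_zero: "x \<in> carrier X \<Longrightarrow> x \<rhd> \<zero>\<^bsub>T\<^esub> = \<zero>\<^bsub>X\<^esub>"

text \<open>
  As for modules in HOL-Algebra, the additive monoid of a bimodule is given by the additive part
  of a ring record; the multiplicative fields carry no meaning.
\<close>

record ('s, 'x, 't) bimodule = "'x ring" +
  lact :: "'s \<Rightarrow> 'x \<Rightarrow> 'x"
  ract :: "'x \<Rightarrow> 't \<Rightarrow> 'x"

locale bimodule =
  left: left_semimodule S X "lact X" + right: right_semimodule T X "ract X"
  for S :: "('s, 'p) ring_scheme" and T :: "('t, 'q) ring_scheme"
    and X :: "('s, 'x, 't, 'r) bimodule_scheme" +
  assumes act_compat: "\<lbrakk>s \<in> carrier S; x \<in> carrier X; t \<in> carrier T\<rbrakk>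
    \<Longrightarrow> lact X s (ract X x t) = ract X (lact X s x) t"

locale kleene_bimodule =
  K: kleene_algebra K + L: kleene_algebra L + bimodule K L X
  for K :: "('k, 'p) kleene_algebra_scheme" and L :: "('l, 'q) kleene_algebra_scheme"
    and X :: "('k, 'x, 'l, 'r) bimodule_scheme" +
  assumes left_star_induct: "\<lbrakk>a \<in> carrier K; x \<in> carrier X; lact X a x \<preceq>\<^bsub>X\<^esub> x\<rbrakk>
      \<Longrightarrow> lact X (a\<^sup>\<star>\<^bsub>K\<^esub>) x \<preceq>\<^bsub>X\<^esub> x"
    and right_star_induct: "\<lbrakk>b \<in> carrier L; x \<in> carrier X; ract X x b \<preceq>\<^bsub>X\<^esub> x\<rbrakk>
      \<Longrightarrow> ract X x (b\<^sup>\<star>\<^bsub>L\<^esub>) \<preceq>\<^bsub>X\<^esub> x"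

definition regular_bimodule :: "('a, 'm) ring_scheme \<Rightarrow> ('a, 'a, 'a) bimodule" where
  "regular_bimodule S =
     \<lparr>carrier = carrier S, mult = mult S, one = \<one>\<^bsub>S\<^esub>, zero = \<zero>\<^bsub>S\<^esub>, add = add S,
      lact = mult S, ract = mult S\<rparr>"

definition bimodule_hom ::
    "('s, 'p) ring_scheme \<Rightarrow> ('t, 'q) ring_scheme \<Rightarrow>
     ('s, 'x, 't, 'u) bimodule_scheme \<Rightarrow> ('s, 'y, 't, 'v) bimodule_scheme \<Rightarrow> ('x \<Rightarrow> 'y) set" where
  "bimodule_hom S T X Y =
     {h \<in> carrier X \<rightarrow> carrier Y.
        (\<forall>x\<in>carrier X. \<forall>y\<in>carrier X. h (x \<oplus>\<^bsub>X\<^esub> y) = h x \<oplus>\<^bsub>Y\<^esub> h y) \<and>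
        (\<forall>s\<in>carrier S. \<forall>x\<in>carrier X. h (lact X s x) = lact Y s (h x)) \<and>
        (\<forall>x\<in>carrier X. \<forall>t\<in>carrier T. h (ract X x t) = ract Y (h x) t)}"

definition bimodule_iso ::
    "('s, 'p) ring_scheme \<Rightarrow> ('t, 'q) ring_scheme \<Rightarrow>
     ('s, 'x, 't, 'u) bimodule_scheme \<Rightarrow> ('s, 'y, 't, 'v) bimodule_scheme \<Rightarrow> bool" where
  "bimodule_iso S T X Y \<longleftrightarrow>
     (\<exists>h\<in>bimodule_hom S T X Y. \<exists>g\<in>bimodule_hom S T Y X.
        (\<forall>x\<in>carrier X. g (h x) = x) \<and> (\<forall>y\<in>carrier Y. h (g y) = y))"

text \<open>Finite formal sums of pairs are finite multisets, i.e. elements of the free commutative monoid.\<close>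

definition formal_sums ::
    "('x, 'p) ring_scheme \<Rightarrow> ('y, 'q) ring_scheme \<Rightarrow> ('x \<times> 'y) multiset set" where
  "formal_sums X Y = {u. set_mset u \<subseteq> carrier X \<times> carrier Y}"

inductive_set tensor_cong ::
    "('b, 'm) ring_scheme \<Rightarrow> ('a, 'x, 'b, 'p) bimodule_scheme \<Rightarrow>
     ('b, 'y, 'c, 'q) bimodule_scheme \<Rightarrow> (('x \<times> 'y) multiset \<times> ('x \<times> 'y) multiset) set"
  for B X Y where
  refl: "u \<in> formal_sums X Y \<Longrightarrow> (u, u) \<in> tensor_cong B X Y"
| sym: "(u, v) \<in> tensor_cong B X Y \<Longrightarrow> (v, u) \<in> tensor_cong B X Y"
| trans: "\<lbrakk>(u, v) \<in> tensor_cong B X Y; (v, w) \<in> tensor_cong B X Y\<rbrakk> \<Longrightarrow> (u, w) \<in> tensor_cong B X Y"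
| plus: "\<lbrakk>(u, u') \<in> tensor_cong B X Y; (v, v') \<in> tensor_cong B X Y\<rbrakk>
    \<Longrightarrow> (u + v, u' + v') \<in> tensor_cong B X Y"
| add_left: "\<lbrakk>x \<in> carrier X; x' \<in> carrier X; y \<in> carrier Y\<rbrakk>
    \<Longrightarrow> ({#(x \<oplus>\<^bsub>X\<^esub> x', y)#}, {#(x, y), (x', y)#}) \<in> tensor_cong B X Y"
| add_right: "\<lbrakk>x \<in> carrier X; y \<in> carrier Y; y' \<in> carrier Y\<rbrakk>
    \<Longrightarrow> ({#(x, y \<oplus>\<^bsub>Y\<^esub> y')#}, {#(x, y), (x, y')#}) \<in> tensor_cong B X Y"
| zero_left: "y \<in> carrier Y \<Longrightarrow> ({#(\<zero>\<^bsub>X\<^esub>, y)#}, {#}) \<in> tensor_cong B X Y"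
| zero_right: "x \<in> carrier X \<Longrightarrow> ({#(x, \<zero>\<^bsub>Y\<^esub>)#}, {#}) \<in> tensor_cong B X Y"
| balanced: "\<lbrakk>x \<in> carrier X; b \<in> carrier B; y \<in> carrier Y\<rbrakk>
    \<Longrightarrow> ({#(ract X x b, y)#}, {#(x, lact Y b y)#}) \<in> tensor_cong B X Y"

definition tensor_product ::
    "('b, 'm) ring_scheme \<Rightarrow> ('a, 'x, 'b, 'p) bimodule_scheme \<Rightarrow>
     ('b, 'y, 'c, 'q) bimodule_scheme \<Rightarrow> ('a, ('x \<times> 'y) multiset set, 'c) bimodule" where
  "tensor_product B X Y =
     \<lparr>carrier = formal_sums X Y // tensor_cong B X Y,
      mult = undefined,
      one = undefined,
      zero = tensor_cong B X Y `` {{#}},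
      add = (\<lambda>U V. \<Union>u\<in>U. \<Union>v\<in>V. tensor_cong B X Y `` {u + v}),
      lact = (\<lambda>a U. \<Union>u\<in>U. tensor_cong B X Y `` {image_mset (\<lambda>(x, y). (lact X a x, y)) u}),
      ract = (\<lambda>U c. \<Union>u\<in>U. tensor_cong B X Y `` {image_mset (\<lambda>(x, y). (x, ract Y y c)) u})\<rparr>"

definition mat_add :: "('a, 'm) ring_scheme \<Rightarrow> 'a mat \<Rightarrow> 'a mat \<Rightarrow> 'a mat" where
  "mat_add K A B = mat (dim_row A) (dim_col A) (\<lambda>ij. A $$ ij \<oplus>\<^bsub>K\<^esub> B $$ ij)"

definition mat_mult :: "('a, 'm) ring_scheme \<Rightarrow> 'a mat \<Rightarrow> 'a mat \<Rightarrow> 'a mat" where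
  "mat_mult K A B = mat (dim_row A) (dim_col B)
     (\<lambda>(i, j). \<Oplus>\<^bsub>K\<^esub>k\<in>{..<dim_col A}. A $$ (i, k) \<otimes>\<^bsub>K\<^esub> B $$ (k, j))"

text \<open>
  The recursion for the asterate splits off the first row and column. Any other block decomposition
  with square diagonal blocks gives the same result, because the asterate of a Kleene algebra is
  determined by its semiring reduct.
\<close>

fun mat_star :: "('a, 'm) kleene_algebra_scheme \<Rightarrow> nat \<Rightarrow> 'a mat \<Rightarrow> 'a mat" where
  "mat_star K 0 A = A"
| "mat_star K (Suc 0) A = map_mat (star K) A"
| "mat_star K (Suc (Suc m)) A =
     (let (a, b, c, d) = split_block A 1 1;
          ds = mat_star K (Suc m) d;
          f = mat_star K (Suc 0) (mat_add K a (mat_mult K b (mat_mult K ds c)));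
          fbds = mat_mult K f (mat_mult K b ds);
          dscf = mat_mult K ds (mat_mult K c f)
      in four_block_mat f fbds dscf (mat_add K ds (mat_mult K dscf (mat_mult K b ds))))"

definition mat_kleene_algebra ::
    "nat \<Rightarrow> ('a, 'm) kleene_algebra_scheme \<Rightarrow> 'a mat kleene_algebra" where
  "mat_kleene_algebra n K =
     \<lparr>carrier = {A \<in> carrier_mat n n. elements_mat A \<subseteq> carrier K},
      mult = mat_mult K,
      one = mat n n (\<lambda>(i, j). if i = j then \<one>\<^bsub>K\<^esub> else \<zero>\<^bsub>K\<^esub>),
      zero = mat n n (\<lambda>_. \<zero>\<^bsub>K\<^esub>),
      add = mat_add K,
      star = mat_star K n\<rparr>"

end

(*
  X is the bimodule of rows and Y the bimodule of columns over K. Multiplying a row by a column and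
  a column by a row gives two associative pairings (a Morita context), each of which reaches the
  unit: 1 = sum of phi(a_i, b_i). Surjectivity already forces the induced map from the tensor product
  to be injective, with inverse r |-> sum of r a_i (x) b_i, since
    sum phi(x, y) a_i (x) b_i = sum x psi(y, a_i) (x) b_i = x (x) sum psi(y, a_i) b_i
      = x (x) sum y phi(a_i, b_i) = x (x) y.
  The Kleene axioms for rows and columns reduce to star induction for the matrix asterate against
  rectangular matrices, which goes through the 2 x 2 block recursion.
*)
theory Submission
  imports Defs
begin

section \<open>Rectangular matrices over a semiring\<close>

text \<open>Both isomorphisms are instances of a single lemma about \<open>p\<close> by
  \<open>q\<close> against \<open>q\<close> by \<open>p\<close> matrices, with (p, q) = (1, n) and
  (n, 1). In it the sum of pairings that reaches the unit is the sum of the diagonal matrix units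
  E_kk for k < p. Each of them factors as E_k0 E_0k through the inner dimension \<open>q\<close>,
  and this is where \<open>q\<close> has to be positive. The obstacle with the tensor product is
  that it is a quotient by a generated congruence, which gives no direct description of a class.
  Identifying the congruence with the kernel of the evaluation map provides one: a class is a fibre
  of that map, and every law about classes becomes an equation in the base semiring. The element f =
  (a + b d* c)* of the block recursion collects the walks that start and end in the first block:
  each move stays inside by a, or leaves by b, wanders by d* and returns by c. This reading explains
  the order of the inequalities in the induction proof: first d*, then the excursion b d* c, then
  f.\<close>

definition mat_over :: "('a, 'm) ring_scheme \<Rightarrow> 'a mat \<Rightarrow> bool" where
  "mat_over K A \<longleftrightarrow> elements_mat A \<subseteq> carrier K"

lemma mat_over_iff:
  "mat_over K A \<longleftrightarrow> (\<forall>i<dim_row A. \<forall>j<dim_col A. A $$ (i, j) \<in> carrier K)"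
  unfolding mat_over_def by blast

lemma mat_overD [simp]:
  "\<lbrakk>mat_over K A; i < dim_row A; j < dim_col A\<rbrakk> \<Longrightarrow> A $$ (i, j) \<in> carrier K"
  by (simp add: mat_over_iff)

lemma mat_overI:
  "(\<And>i j. \<lbrakk>i < dim_row A; j < dim_col A\<rbrakk> \<Longrightarrow> A $$ (i, j) \<in> carrier K) \<Longrightarrow> mat_over K A"
  by (simp add: mat_over_iff)

notation
  mat_add (\<open>(_ \<boxplus>\<index> _)\<close> [65, 66] 65) and
  mat_mult (\<open>(_ \<boxdot>\<index> _)\<close> [70, 71] 70)

context semiring
begin

abbreviation mat_one :: "nat \<Rightarrow> 'a mat" where
  "mat_one n \<equiv> mat n n (\<lambda>(i, j). if i = j then \<one> else \<zero>)"

abbreviation mat_zero :: "nat \<Rightarrow> nat \<Rightarrow> 'a mat" where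
  "mat_zero r c \<equiv> mat r c (\<lambda>_. \<zero>)"

section \<open>Finite sums over index ranges\<close>

lemma finsum_lessThan_one: "f 0 \<in> carrier R \<Longrightarrow> finsum R f {..<Suc 0} = f 0"
  by (simp add: lessThan_Suc)

text \<open>This cuts the summation index of a matrix product at a block boundary, which is what
  multiplication of block matrices needs.\<close>

lemma finsum_lessThan_add:
  fixes r s :: nat
  assumes "\<And>i. i < r + s \<Longrightarrow> f i \<in> carrier R"
  shows "(\<Oplus>i\<in>{..<r + s}. f i) = (\<Oplus>i\<in>{..<r}. f i) \<oplus> (\<Oplus>i\<in>{..<s}. f (r + i))"
  using assms
proof (induction s)
  case 0
  then show ?case by (simp add: Pi_def)
next
  case (Suc s)
  then have "f (r + s) \<in> carrier R" "f \<in> {..<r + s} \<rightarrow> carrier R" "f \<in> {..<r} \<rightarrow> carrier R"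
    "(\<lambda>i. f (r + i)) \<in> {..<s} \<rightarrow> carrier R"
    by auto
  with Suc show ?case
    by (simp add: lessThan_Suc a_ac)
qed

lemma finsum_commute:
  assumes "finite A" "finite B" "\<And>i j. i \<in> A \<Longrightarrow> j \<in> B \<Longrightarrow> f i j \<in> carrier R"
  shows "(\<Oplus>i\<in>A. \<Oplus>j\<in>B. f i j) = (\<Oplus>j\<in>B. \<Oplus>i\<in>A. f i j)"
  using assms(1,3)
proof (induction A rule: finite_induct)
  case empty
  then show ?case by simp
next
  case (insert x F)
  have "(\<Oplus>i\<in>insert x F. \<Oplus>j\<in>B. f i j) = (\<Oplus>j\<in>B. f x j) \<oplus> (\<Oplus>j\<in>B. \<Oplus>i\<in>F. f i j)"
    using insert by (subst finsum_insert) (auto intro!: finsum_closed)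
  also have "\<dots> = (\<Oplus>j\<in>B. f x j \<oplus> (\<Oplus>i\<in>F. f i j))"
    using insert.prems by (intro finsum_addf [symmetric]) (auto intro!: finsum_closed)
  also have "\<dots> = (\<Oplus>j\<in>B. \<Oplus>i\<in>insert x F. f i j)"
    using insert by (intro finsum_cong') (auto intro!: finsum_closed)
  finally show ?case .
qed

lemma finsum_delta:
  assumes "finite A" "i \<in> A" "f i \<in> carrier R"
  shows "(\<Oplus>j\<in>A. if i = j then f j else \<zero>) = f i" and "(\<Oplus>j\<in>A. if j = i then f j else \<zero>) = f i"
proof -
  have "(\<Oplus>j\<in>A. if j = i then f j else \<zero>) = (\<Oplus>j\<in>insert i (A - {i}). if j = i then f j else \<zero>)"
    using assms by (simp add: insert_absorb)
  also have "\<dots> = f i \<oplus> (\<Oplus>j\<in>A - {i}. if j = i then f j else \<zero>)"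
    using assms by (subst finsum_insert) auto
  also have "(\<Oplus>j\<in>A - {i}. if j = i then f j else \<zero>) = \<zero>"
    by (rule add.finprod_one_eqI) auto
  finally show *: "(\<Oplus>j\<in>A. if j = i then f j else \<zero>) = f i"
    using assms by simp
  then show "(\<Oplus>j\<in>A. if i = j then f j else \<zero>) = f i"
    by (simp add: eq_commute)
qed

section \<open>Entrywise laws of matrix addition and multiplication\<close>

lemma mat_add_simps [simp]:
  "dim_row (A \<boxplus> B) = dim_row A" "dim_col (A \<boxplus> B) = dim_col A"
  "\<lbrakk>i < dim_row A; j < dim_col A\<rbrakk> \<Longrightarrow> (A \<boxplus> B) $$ (i, j) = A $$ (i, j) \<oplus> B $$ (i, j)"
  by (simp_all add: mat_add_def)

lemma mat_mult_simps [simp]: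
  "dim_row (A \<boxdot> B) = dim_row A" "dim_col (A \<boxdot> B) = dim_col B"
  "\<lbrakk>i < dim_row A; j < dim_col B\<rbrakk> \<Longrightarrow>
    (A \<boxdot> B) $$ (i, j) = (\<Oplus>k\<in>{..<dim_col A}. A $$ (i, k) \<otimes> B $$ (k, j))"
  by (simp_all add: mat_mult_def)

lemma mat_over_simps [simp]:
  "\<lbrakk>mat_over R A; mat_over R B; dim_row A = dim_row B; dim_col A = dim_col B\<rbrakk>
    \<Longrightarrow> mat_over R (A \<boxplus> B)"
  "\<lbrakk>mat_over R A; mat_over R B; dim_col A = dim_row B\<rbrakk> \<Longrightarrow> mat_over R (A \<boxdot> B)"
  "mat_over R (mat_one n)"
  "mat_over R (mat_zero r c)"
  by (auto simp: mat_over_iff intro!: finsum_closed)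

lemma mat_mult_index_closed:
  assumes "mat_over R A" "mat_over R B" "dim_col A = dim_row B" "i < dim_row A" "j < dim_col B"
  shows "(\<Oplus>k\<in>{..<dim_row B}. A $$ (i, k) \<otimes> B $$ (k, j)) \<in> carrier R"
  using assms by (auto intro!: finsum_closed)

lemma mat_add_assoc:
  "\<lbrakk>mat_over R A; mat_over R B; mat_over R C; dim_row A = dim_row B; dim_col A = dim_col B;
    dim_row B = dim_row C; dim_col B = dim_col C\<rbrakk> \<Longrightarrow> A \<boxplus> B \<boxplus> C = A \<boxplus> (B \<boxplus> C)"
  by (rule eq_matI) (auto simp: a_assoc)

lemma mat_add_commute:
  "\<lbrakk>mat_over R A; mat_over R B; dim_row A = dim_row B; dim_col A = dim_col B\<rbrakk>
    \<Longrightarrow> A \<boxplus> B = B \<boxplus> A"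
  by (rule eq_matI) (auto simp: a_comm)

lemma mat_add_left_commute:
  "\<lbrakk>mat_over R A; mat_over R B; mat_over R C; dim_row A = dim_row B; dim_col A = dim_col B;
    dim_row B = dim_row C; dim_col B = dim_col C\<rbrakk> \<Longrightarrow> A \<boxplus> (B \<boxplus> C) = B \<boxplus> (A \<boxplus> C)"
  by (rule eq_matI) (auto simp: a_lcomm)

lemmas mat_add_ac = mat_add_assoc mat_add_commute mat_add_left_commute

lemma mat_add_zero [simp]:
  "\<lbrakk>mat_over R A; dim_row A = r; dim_col A = c\<rbrakk> \<Longrightarrow> A \<boxplus> mat_zero r c = A"
  "\<lbrakk>mat_over R A; dim_row A = r; dim_col A = c\<rbrakk> \<Longrightarrow> mat_zero r c \<boxplus> A = A"
  by (auto intro!: eq_matI)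

lemma mat_mult_distrib_left:
  assumes "mat_over R A" "mat_over R B" "mat_over R C" "dim_row B = dim_row C" "dim_col B = dim_col C"
    "dim_col A = dim_row B"
  shows "A \<boxdot> (B \<boxplus> C) = A \<boxdot> B \<boxplus> A \<boxdot> C"
proof (rule eq_matI)
  fix i j
  assume "i < dim_row (A \<boxdot> B \<boxplus> A \<boxdot> C)" "j < dim_col (A \<boxdot> B \<boxplus> A \<boxdot> C)"
  then have ij: "i < dim_row A" "j < dim_col C" using assms by simp_all
  have "(A \<boxdot> (B \<boxplus> C)) $$ (i, j) =
      (\<Oplus>k\<in>{..<dim_col A}. A $$ (i, k) \<otimes> B $$ (k, j) \<oplus> A $$ (i, k) \<otimes> C $$ (k, j))"
    using assms ij by (intro HOL.trans [OF mat_mult_simps(3) finsum_cong']) (auto simp: r_distr)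
  also have "\<dots> = (A \<boxdot> B \<boxplus> A \<boxdot> C) $$ (i, j)"
    using assms ij by (simp add: finsum_addf Pi_def)
  finally show "(A \<boxdot> (B \<boxplus> C)) $$ (i, j) = (A \<boxdot> B \<boxplus> A \<boxdot> C) $$ (i, j)" .
qed (use assms in simp_all)

lemma mat_mult_distrib_right:
  assumes "mat_over R A" "mat_over R B" "mat_over R C" "dim_row A = dim_row B" "dim_col A = dim_col B"
    "dim_col A = dim_row C"
  shows "(A \<boxplus> B) \<boxdot> C = A \<boxdot> C \<boxplus> B \<boxdot> C"
proof (rule eq_matI)
  fix i j
  assume "i < dim_row (A \<boxdot> C \<boxplus> B \<boxdot> C)" "j < dim_col (A \<boxdot> C \<boxplus> B \<boxdot> C)"
  then have ij: "i < dim_row B" "j < dim_col C" using assms by simp_all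
  have "((A \<boxplus> B) \<boxdot> C) $$ (i, j) =
      (\<Oplus>k\<in>{..<dim_col A}. A $$ (i, k) \<otimes> C $$ (k, j) \<oplus> B $$ (i, k) \<otimes> C $$ (k, j))"
    using assms ij by (intro HOL.trans [OF mat_mult_simps(3) finsum_cong']) (auto simp: l_distr)
  also have "\<dots> = (A \<boxdot> C \<boxplus> B \<boxdot> C) $$ (i, j)"
    using assms ij by (simp add: finsum_addf Pi_def)
  finally show "((A \<boxplus> B) \<boxdot> C) $$ (i, j) = (A \<boxdot> C \<boxplus> B \<boxdot> C) $$ (i, j)" .
qed (use assms in simp_all)

lemma mat_mult_zero [simp]:
  "\<lbrakk>mat_over R A; dim_col A = r\<rbrakk> \<Longrightarrow> A \<boxdot> mat_zero r c = mat_zero (dim_row A) c"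
  "\<lbrakk>mat_over R A; dim_row A = c\<rbrakk> \<Longrightarrow> mat_zero r c \<boxdot> A = mat_zero r (dim_col A)"
  by (auto intro!: eq_matI add.finprod_one_eqI)

lemma mat_mult_one [simp]:
  assumes "mat_over R A"
  shows "dim_col A = n \<Longrightarrow> A \<boxdot> mat_one n = A" "dim_row A = n \<Longrightarrow> mat_one n \<boxdot> A = A"
proof -
  have *: "(\<Oplus>k\<in>{..<dim_col A}. A $$ (i, k) \<otimes> (if k = j then \<one> else \<zero>)) = A $$ (i, j)"
    "(\<Oplus>k\<in>{..<dim_row A}. (if i = k then \<one> else \<zero>) \<otimes> A $$ (k, j)) = A $$ (i, j)"
    if "i < dim_row A" "j < dim_col A" for i j
  proof -
    have "(\<Oplus>k\<in>{..<dim_col A}. A $$ (i, k) \<otimes> (if k = j then \<one> else \<zero>)) =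
        (\<Oplus>k\<in>{..<dim_col A}. if k = j then A $$ (i, k) else \<zero>)"
      using assms that by (intro finsum_cong') auto
    also have "\<dots> = A $$ (i, j)"
      using assms that by (intro finsum_delta) auto
    finally show "(\<Oplus>k\<in>{..<dim_col A}. A $$ (i, k) \<otimes> (if k = j then \<one> else \<zero>)) = A $$ (i, j)" .
    have "(\<Oplus>k\<in>{..<dim_row A}. (if i = k then \<one> else \<zero>) \<otimes> A $$ (k, j)) =
        (\<Oplus>k\<in>{..<dim_row A}. if i = k then A $$ (k, j) else \<zero>)"
      using assms that by (intro finsum_cong') auto
    also have "\<dots> = A $$ (i, j)"
      using assms that by (intro finsum_delta(1) [where f = "\<lambda>k. A $$ (k, j)"]) auto
    finally show "(\<Oplus>k\<in>{..<dim_row A}. (if i = k then \<one> else \<zero>) \<otimes> A $$ (k, j)) = A $$ (i, j)" .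
  qed
  \<comment> \<open>The delta has to be written out under the sum: plain simplification would leave
    an entry of \<open>mat_one n\<close> there, without the bound on \<open>k\<close> that is needed
    to evaluate it.\<close>
  have idx: "(A \<boxdot> mat_one n) $$ (i, j) = (\<Oplus>k\<in>{..<dim_col A}. A $$ (i, k) \<otimes> (if k = j then \<one> else \<zero>))"
    if "dim_col A = n" "i < dim_row A" "j < n" for i j
    using assms that by (auto intro!: finsum_cong')
  have idx': "(mat_one n \<boxdot> A) $$ (i, j) = (\<Oplus>k\<in>{..<dim_row A}. (if i = k then \<one> else \<zero>) \<otimes> A $$ (k, j))"
    if "dim_row A = n" "i < n" "j < dim_col A" for i j
    using assms that by (auto intro!: finsum_cong')
  show "dim_col A = n \<Longrightarrow> A \<boxdot> mat_one n = A"
    using idx * by (auto intro!: eq_matI simp del: mat_mult_simps(3))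
  show "dim_row A = n \<Longrightarrow> mat_one n \<boxdot> A = A"
    using idx' * by (auto intro!: eq_matI simp del: mat_mult_simps(3))
qed

lemma mat_mult_assoc:
  assumes "mat_over R A" "mat_over R B" "mat_over R C"
    "dim_col A = dim_row B" "dim_col B = dim_row C"
  shows "A \<boxdot> B \<boxdot> C = A \<boxdot> (B \<boxdot> C)"
proof (rule eq_matI)
  fix i j
  assume "i < dim_row (A \<boxdot> (B \<boxdot> C))" "j < dim_col (A \<boxdot> (B \<boxdot> C))"
  then have ij: "i < dim_row A" "j < dim_col C" by simp_all
  have "(A \<boxdot> B \<boxdot> C) $$ (i, j) =
      (\<Oplus>l\<in>{..<dim_row C}. (\<Oplus>k\<in>{..<dim_row B}. A $$ (i, k) \<otimes> B $$ (k, l)) \<otimes> C $$ (l, j))"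
    using assms ij by (auto intro!: finsum_cong' mat_mult_index_closed)
  also have "\<dots> = (\<Oplus>l\<in>{..<dim_row C}. \<Oplus>k\<in>{..<dim_row B}. A $$ (i, k) \<otimes> (B $$ (k, l) \<otimes> C $$ (l, j)))"
    using assms ij
    by (intro finsum_cong') (auto simp: finsum_ldistr Pi_def m_assoc intro!: finsum_closed finsum_cong')
  also have "\<dots> = (\<Oplus>k\<in>{..<dim_row B}. \<Oplus>l\<in>{..<dim_row C}. A $$ (i, k) \<otimes> (B $$ (k, l) \<otimes> C $$ (l, j)))"
    using assms ij by (intro finsum_commute) auto
  also have "\<dots> = (\<Oplus>k\<in>{..<dim_row B}. A $$ (i, k) \<otimes> (\<Oplus>l\<in>{..<dim_row C}. B $$ (k, l) \<otimes> C $$ (l, j)))"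
    using assms ij
    by (intro finsum_cong') (auto simp: finsum_rdistr Pi_def intro!: finsum_closed finsum_cong')
  also have "\<dots> = (A \<boxdot> (B \<boxdot> C)) $$ (i, j)"
    using assms ij by (auto intro!: finsum_cong' finsum_closed mat_mult_index_closed)
  finally show "(A \<boxdot> B \<boxdot> C) $$ (i, j) = (A \<boxdot> (B \<boxdot> C)) $$ (i, j)" .
qed simp_all

section \<open>Block matrices\<close>

lemma mat_over_four_block [simp]:
  assumes "dim_row B = dim_row A" "dim_col C = dim_col A" "dim_row C = dim_row D" "dim_col B = dim_col D"
  shows "mat_over R (four_block_mat A B C D) \<longleftrightarrow>
    mat_over R A \<and> mat_over R B \<and> mat_over R C \<and> mat_over R D" (is "?l \<longleftrightarrow> ?r")
proof
  assume l: ?l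
  have F: "four_block_mat A B C D $$ (i, j) \<in> carrier R"
    if "i < dim_row A + dim_row D" "j < dim_col A + dim_col D" for i j
    using mat_overD [OF l, of i j] that by (simp del: index_mat_four_block(1))
  show ?r
    unfolding mat_over_iff
  proof (intro conjI allI impI)
    show "A $$ (i, j) \<in> carrier R" if "i < dim_row A" "j < dim_col A" for i j
      using F [of i j] assms that by simp
    show "B $$ (i, j) \<in> carrier R" if "i < dim_row B" "j < dim_col B" for i j
      using F [of i "dim_col A + j"] assms that by simp
    show "C $$ (i, j) \<in> carrier R" if "i < dim_row C" "j < dim_col C" for i j
      using F [of "dim_row A + i" j] assms that by simp
    show "D $$ (i, j) \<in> carrier R" if "i < dim_row D" "j < dim_col D" for i j
      using F [of "dim_row A + i" "dim_col A + j"] assms that by simp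
  qed
next
  assume ?r
  with assms show ?l
    by (auto simp: mat_over_iff)
qed

text \<open>Equal dimensions put corresponding blocks at the same offsets, so each block can be read
  off at shifted indices. Since the order is an equation, this also turns an inequality between
  block matrices into inequalities between blocks.\<close>

lemma four_block_mat_inject:
  assumes "four_block_mat A B C D = four_block_mat A' B' C' D'"
    "dim_row A = dim_row A'" "dim_col A = dim_col A'" "dim_row D = dim_row D'" "dim_col D = dim_col D'"
    "dim_row B = dim_row A" "dim_col C = dim_col A" "dim_row C = dim_row D" "dim_col B = dim_col D"
    "dim_row B' = dim_row A'" "dim_col C' = dim_col A'" "dim_row C' = dim_row D'" "dim_col B' = dim_col D'"
  shows "A = A' \<and> B = B' \<and> C = C' \<and> D = D'"
proof -
  have F: "four_block_mat A B C D $$ (i, j) = four_block_mat A' B' C' D' $$ (i, j)" for i j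
    using assms(1) by simp
  show ?thesis
  proof (intro conjI eq_matI)
    show "A $$ (i, j) = A' $$ (i, j)" if "i < dim_row A'" "j < dim_col A'" for i j
      using F [of i j] assms(2-) that by simp
    show "B $$ (i, j) = B' $$ (i, j)" if "i < dim_row B'" "j < dim_col B'" for i j
      using F [of i "dim_col A + j"] assms(2-) that by simp
    show "C $$ (i, j) = C' $$ (i, j)" if "i < dim_row C'" "j < dim_col C'" for i j
      using F [of "dim_row A + i" j] assms(2-) that by simp
    show "D $$ (i, j) = D' $$ (i, j)" if "i < dim_row D'" "j < dim_col D'" for i j
      using F [of "dim_row A + i" "dim_col A + j"] assms(2-) that by simp
  qed (use assms in simp_all)
qed

lemma mat_add_four_block:
  assumes "dim_row A = dim_row A'" "dim_col A = dim_col A'" "dim_row D = dim_row D'" "dim_col D = dim_col D'"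
    "dim_row B = dim_row A" "dim_col C = dim_col A" "dim_row C = dim_row D" "dim_col B = dim_col D"
    "dim_row B' = dim_row A'" "dim_col C' = dim_col A'" "dim_row C' = dim_row D'" "dim_col B' = dim_col D'"
  shows "four_block_mat A B C D \<boxplus> four_block_mat A' B' C' D' =
    four_block_mat (A \<boxplus> A') (B \<boxplus> B') (C \<boxplus> C') (D \<boxplus> D')"
  using assms by (intro eq_matI) auto

lemma mat_mult_four_block:
  assumes over: "mat_over R A" "mat_over R B" "mat_over R C" "mat_over R D"
    "mat_over R A'" "mat_over R B'" "mat_over R C'" "mat_over R D'"
    and dims: "dim_row B = dim_row A" "dim_col C = dim_col A" "dim_row C = dim_row D" "dim_col B = dim_col D"
    "dim_row B' = dim_row A'" "dim_col C' = dim_col A'" "dim_row C' = dim_row D'" "dim_col B' = dim_col D'"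
    "dim_col A = dim_row A'" "dim_col D = dim_row D'"
  shows "four_block_mat A B C D \<boxdot> four_block_mat A' B' C' D' =
    four_block_mat (A \<boxdot> A' \<boxplus> B \<boxdot> C') (A \<boxdot> B' \<boxplus> B \<boxdot> D') (C \<boxdot> A' \<boxplus> D \<boxdot> C') (C \<boxdot> B' \<boxplus> D \<boxdot> D')"
    (is "?F \<boxdot> ?G = ?H")
proof (rule eq_matI)
  fix i j
  assume "i < dim_row ?H" "j < dim_col ?H"
  then have ij: "i < dim_row A + dim_row D" "j < dim_col A' + dim_col D'"
    using dims by auto
  have FG: "mat_over R ?F" "mat_over R ?G"
    using over dims by simp_all
  have "(?F \<boxdot> ?G) $$ (i, j) = (\<Oplus>k\<in>{..<dim_row A' + dim_row D'}. ?F $$ (i, k) \<otimes> ?G $$ (k, j))"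
    using ij dims by (simp del: index_mat_four_block(1))
  \<comment> \<open>The summation index runs over the rows of the second factor, so it is cut after
    the rows of \<open>A'\<close>; each half gives one of the two products in a block of
    \<open>?H\<close>.\<close>
  also have "\<dots> = (\<Oplus>k\<in>{..<dim_row A'}. ?F $$ (i, k) \<otimes> ?G $$ (k, j)) \<oplus>
      (\<Oplus>k\<in>{..<dim_row D'}. ?F $$ (i, dim_row A' + k) \<otimes> ?G $$ (dim_row A' + k, j))"
    using ij dims FG by (intro finsum_lessThan_add) (simp del: index_mat_four_block(1))
  also have "\<dots> = ?H $$ (i, j)"
    using ij over dims by (auto intro!: arg_cong2 [where f = "(\<oplus>)"] finsum_cong')
  finally show "(?F \<boxdot> ?G) $$ (i, j) = ?H $$ (i, j)" .
qed (use dims in simp_all)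

lemma mat_one_four_block:
  "mat_one (r + s) = four_block_mat (mat_one r) (mat_zero r s) (mat_zero s r) (mat_one s)"
  by (rule eq_matI) auto

end

section \<open>The asterate of a matrix\<close>

context kleene_algebra
begin

section \<open>The order on rectangular matrices\<close>

abbreviation mat_le :: "'a mat \<Rightarrow> 'a mat \<Rightarrow> bool" (infix \<open>\<sqsubseteq>\<close> 50) where
  "A \<sqsubseteq> B \<equiv> A \<boxplus> B = B"

lemma mat_add_idem: "mat_over K A \<Longrightarrow> A \<boxplus> A = A"
  by (rule eq_matI) (auto simp: add_idem)

lemma mat_le_trans:
  assumes "A \<sqsubseteq> B" "B \<sqsubseteq> C" "mat_over K A" "mat_over K B" "mat_over K C"
    "dim_row A = dim_row B" "dim_col A = dim_col B" "dim_row B = dim_row C" "dim_col B = dim_col C"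
  shows "A \<sqsubseteq> C"
  using assms by (metis mat_add_assoc)

lemma mat_add_le_iff:
  assumes "mat_over K A" "mat_over K B" "mat_over K C"
    "dim_row A = dim_row B" "dim_col A = dim_col B" "dim_row B = dim_row C" "dim_col B = dim_col C"
  shows "A \<boxplus> B \<sqsubseteq> C \<longleftrightarrow> A \<sqsubseteq> C \<and> B \<sqsubseteq> C"
proof
  assume le: "A \<boxplus> B \<sqsubseteq> C"
  \<comment> \<open>\<open>le\<close> collapses the inner sum on the left to \<open>C\<close>; on
    the right, idempotence absorbs the repeated summand, and \<open>le\<close> then collapses the
    rest to \<open>C\<close> as well.\<close>
  have "A \<boxplus> (A \<boxplus> B \<boxplus> C) = A \<boxplus> A \<boxplus> B \<boxplus> C" "B \<boxplus> (A \<boxplus> B \<boxplus> C) = A \<boxplus> (B \<boxplus> B) \<boxplus> C"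
    using assms by (simp_all add: mat_add_ac)
  with le assms show "A \<sqsubseteq> C \<and> B \<sqsubseteq> C"
    by (simp add: mat_add_idem)
next
  assume "A \<sqsubseteq> C \<and> B \<sqsubseteq> C"
  with assms show "A \<boxplus> B \<sqsubseteq> C"
    by (simp add: mat_add_assoc)
qed

text \<open>With the order given by addition, monotonicity is distributivity read backwards: C A + C
  B = C (A + B) = C B.\<close>

lemma mat_mult_mono_left:
  assumes "A \<sqsubseteq> B" "mat_over K A" "mat_over K B" "mat_over K C"
    "dim_row A = dim_row B" "dim_col A = dim_col B" "dim_col C = dim_row A"
  shows "C \<boxdot> A \<sqsubseteq> C \<boxdot> B"
  using assms by (simp add: mat_mult_distrib_left [symmetric])

lemma mat_mult_mono_right:
  assumes "A \<sqsubseteq> B" "mat_over K A" "mat_over K B" "mat_over K C"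
    "dim_row A = dim_row B" "dim_col A = dim_col B" "dim_row C = dim_col A"
  shows "A \<boxdot> C \<sqsubseteq> B \<boxdot> C"
  using assms by (simp add: mat_mult_distrib_right [symmetric])

text \<open>
  Induction against rectangular \<open>Z\<close>, not only square ones, is what the block recursion needs; it
  is also exactly the Kleene module axiom for rectangular matrices.
\<close>

definition is_asterate :: "'a mat \<Rightarrow> 'a mat \<Rightarrow> bool" where
  "is_asterate A S \<longleftrightarrow>
     mat_over K S \<and> dim_row S = dim_row A \<and> dim_col S = dim_row A \<and>
     mat_one (dim_row A) \<boxplus> A \<boxdot> S = S \<and> mat_one (dim_row A) \<boxplus> S \<boxdot> A = S \<and>
     (\<forall>Z. mat_over K Z \<longrightarrow> dim_row Z = dim_row A \<longrightarrow> A \<boxdot> Z \<sqsubseteq> Z \<longrightarrow> S \<boxdot> Z \<sqsubseteq> Z) \<and>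
     (\<forall>Z. mat_over K Z \<longrightarrow> dim_col Z = dim_row A \<longrightarrow> Z \<boxdot> A \<sqsubseteq> Z \<longrightarrow> Z \<boxdot> S \<sqsubseteq> Z)"

lemma is_asterateD:
  assumes "is_asterate A S"
  shows "mat_over K S" "dim_row S = dim_row A" "dim_col S = dim_row A"
    "mat_one (dim_row A) \<boxplus> A \<boxdot> S = S" "mat_one (dim_row A) \<boxplus> S \<boxdot> A = S"
    "\<And>Z. \<lbrakk>mat_over K Z; dim_row Z = dim_row A; A \<boxdot> Z \<sqsubseteq> Z\<rbrakk> \<Longrightarrow> S \<boxdot> Z \<sqsubseteq> Z"
    "\<And>Z. \<lbrakk>mat_over K Z; dim_col Z = dim_row A; Z \<boxdot> A \<sqsubseteq> Z\<rbrakk> \<Longrightarrow> Z \<boxdot> S \<sqsubseteq> Z"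
  using assms unfolding is_asterate_def by auto

section \<open>Asterates of 1 by 1 and of block matrices\<close>

lemma is_asterate_one_by_one:
  assumes A: "mat_over K A" "dim_row A = 1" "dim_col A = 1"
  shows "is_asterate A (map_mat (star K) A)"
proof -
  let ?a = "A $$ (0, 0)"
  have a: "?a \<in> carrier K" "?a\<^sup>\<star> \<in> carrier K"
    using A by (auto intro: star_closed)
  \<comment> \<open>This is the induction axiom with its first argument taken to be \<open>z\<close>
    itself; idempotence turns az <= z into its premise z + az <= z. A matrix with one row is then
    handled entry by entry.\<close>
  have left: "?a\<^sup>\<star> \<otimes> z \<oplus> z = z" if "?a \<otimes> z \<oplus> z = z" "z \<in> carrier K" for z
    using star_induct_left [of z ?a z] a that
    by (simp add: add_le_def a_ac add_idem)
  have right: "z \<otimes> ?a\<^sup>\<star> \<oplus> z = z" if "z \<otimes> ?a \<oplus> z = z" "z \<in> carrier K" for z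
    using star_induct_right [of z ?a z] a that
    by (simp add: add_le_def a_ac add_idem)
  show ?thesis
    unfolding is_asterate_def
  proof (intro conjI allI impI)
    show "mat_over K (map_mat (star K) A)"
      using A a by (intro mat_overI) simp
    show "mat_one (dim_row A) \<boxplus> A \<boxdot> map_mat (star K) A = map_mat (star K) A"
      using A a by (intro eq_matI) (simp_all add: finsum_lessThan_one star_unfold_left)
    show "mat_one (dim_row A) \<boxplus> map_mat (star K) A \<boxdot> A = map_mat (star K) A"
      using A a by (intro eq_matI) (simp_all add: finsum_lessThan_one star_unfold_right)
  next
    fix Z
    assume Z: "mat_over K Z" "dim_row Z = dim_row A" and le: "A \<boxdot> Z \<sqsubseteq> Z"
    have "?a \<otimes> Z $$ (0, j) \<oplus> Z $$ (0, j) = Z $$ (0, j)" if "j < dim_col Z" for j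
      using arg_cong [OF le, of "\<lambda>C. C $$ (0, j)"] A Z that a by (simp add: finsum_lessThan_one)
    then show "map_mat (star K) A \<boxdot> Z \<sqsubseteq> Z"
      using A a Z by (intro eq_matI) (simp_all add: finsum_lessThan_one left)
  next
    fix Z
    assume Z: "mat_over K Z" "dim_col Z = dim_row A" and le: "Z \<boxdot> A \<sqsubseteq> Z"
    have "Z $$ (i, 0) \<otimes> ?a \<oplus> Z $$ (i, 0) = Z $$ (i, 0)" if "i < dim_row Z" for i
      using arg_cong [OF le, of "\<lambda>C. C $$ (i, 0)"] A Z that a by (simp add: finsum_lessThan_one)
    then show "Z \<boxdot> map_mat (star K) A \<sqsubseteq> Z"
      using A a Z by (intro eq_matI) (simp_all add: finsum_lessThan_one right)
  qed (use A in simp_all)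
qed

lemma mat_split:
  assumes "mat_over K Z" "dim_row Z = r + s" "dim_col Z = p + q"
  obtains A B C D where "Z = four_block_mat A B C D"
    "mat_over K A" "mat_over K B" "mat_over K C" "mat_over K D"
    "dim_row A = r" "dim_row B = r" "dim_row C = s" "dim_row D = s"
    "dim_col A = p" "dim_col B = q" "dim_col C = p" "dim_col D = q"
proof -
  obtain A B C D where "split_block Z r p = (A, B, C, D)"
    by (metis prod_cases4)
  from split_block [OF this assms(2,3)]
  have *: "dim_row A = r" "dim_row B = r" "dim_row C = s" "dim_row D = s"
    "dim_col A = p" "dim_col B = q" "dim_col C = p" "dim_col D = q"
    and Z: "Z = four_block_mat A B C D"
    by auto
  with assms(1) have "mat_over K A" "mat_over K B" "mat_over K C" "mat_over K D"
    by simp_all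
  with Z * that show thesis by blast
qed

text \<open>Each block of the unfolding laws is an unfolding of \<open>f\<close> or
  \<open>ds\<close>, multiplied by the remaining factors. For induction, if a column with parts z, w
  is closed under \<open>a\<close>, \<open>b\<close>, \<open>c\<close>, \<open>d\<close>, then
  \<open>ds\<close> keeps w below w, hence a + b ds c keeps z below z, and so does \<open>f\<close>;
  every entry of the candidate is composed of such moves.\<close>

lemma is_asterate_four_block:
  assumes over [simp]: "mat_over K a" "mat_over K b" "mat_over K c" "mat_over K d"
    and dims [simp]: "dim_row a = r" "dim_col a = r" "dim_row b = r" "dim_col b = s"
      "dim_row c = s" "dim_col c = r" "dim_row d = s" "dim_col d = s"
    and ds: "is_asterate d ds"
    and f: "is_asterate (a \<boxplus> b \<boxdot> (ds \<boxdot> c)) f"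
  shows "is_asterate (four_block_mat a b c d)
    (four_block_mat f (f \<boxdot> (b \<boxdot> ds)) (ds \<boxdot> (c \<boxdot> f)) (ds \<boxplus> ds \<boxdot> (c \<boxdot> f) \<boxdot> (b \<boxdot> ds)))"
    (is "is_asterate ?A ?S")
proof -
  note ds' = is_asterateD [OF ds, simplified dims]
  note f' = is_asterateD [OF f, simplified dims mat_add_simps]
  note [simp] = ds'(1-3) f'(1-3)
  note dist = mat_mult_assoc mat_mult_distrib_left mat_mult_distrib_right
  have "mat_one r \<boxplus> (a \<boxdot> f \<boxplus> b \<boxdot> (ds \<boxdot> (c \<boxdot> f))) = f"
    using f'(4) by (simp add: dist)
  \<comment> \<open>The top right block: unfold the leading \<open>f\<close> once on the left and
    multiply out. The lower blocks unfold \<open>ds\<close> in the same way.\<close>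
  moreover have "a \<boxdot> (f \<boxdot> (b \<boxdot> ds)) \<boxplus> b \<boxdot> (ds \<boxplus> ds \<boxdot> (c \<boxdot> f) \<boxdot> (b \<boxdot> ds)) = f \<boxdot> (b \<boxdot> ds)"
  proof -
    have "f \<boxdot> (b \<boxdot> ds) = (mat_one r \<boxplus> (a \<boxplus> b \<boxdot> (ds \<boxdot> c)) \<boxdot> f) \<boxdot> (b \<boxdot> ds)"
      by (simp only: f'(4))
    also have "\<dots> = a \<boxdot> (f \<boxdot> (b \<boxdot> ds)) \<boxplus> b \<boxdot> (ds \<boxplus> ds \<boxdot> (c \<boxdot> f) \<boxdot> (b \<boxdot> ds))"
      by (simp add: dist mat_add_ac)
    finally show ?thesis by simp
  qed
  moreover have "c \<boxdot> f \<boxplus> d \<boxdot> (ds \<boxdot> (c \<boxdot> f)) = ds \<boxdot> (c \<boxdot> f)"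
  proof -
    have "ds \<boxdot> (c \<boxdot> f) = (mat_one s \<boxplus> d \<boxdot> ds) \<boxdot> (c \<boxdot> f)"
      by (simp only: ds'(4))
    also have "\<dots> = c \<boxdot> f \<boxplus> d \<boxdot> (ds \<boxdot> (c \<boxdot> f))"
      by (simp add: dist)
    finally show ?thesis by simp
  qed
  moreover have "mat_one s \<boxplus> (c \<boxdot> (f \<boxdot> (b \<boxdot> ds)) \<boxplus> d \<boxdot> (ds \<boxplus> ds \<boxdot> (c \<boxdot> f) \<boxdot> (b \<boxdot> ds))) =
      ds \<boxplus> ds \<boxdot> (c \<boxdot> f) \<boxdot> (b \<boxdot> ds)"
  proof -
    let ?P = "c \<boxdot> (f \<boxdot> (b \<boxdot> ds))"
    have "ds \<boxplus> ds \<boxdot> (c \<boxdot> f) \<boxdot> (b \<boxdot> ds) = ds \<boxplus> ds \<boxdot> ?P"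
      by (simp add: dist)
    also have "\<dots> = (mat_one s \<boxplus> d \<boxdot> ds) \<boxplus> (mat_one s \<boxplus> d \<boxdot> ds) \<boxdot> ?P"
      by (simp only: ds'(4))
    also have "\<dots> = mat_one s \<boxplus> (?P \<boxplus> d \<boxdot> (ds \<boxplus> ds \<boxdot> (c \<boxdot> f) \<boxdot> (b \<boxdot> ds)))"
      by (simp add: dist mat_add_ac)
    finally show ?thesis by simp
  qed
  ultimately have unfold_left: "mat_one (r + s) \<boxplus> ?A \<boxdot> ?S = ?S"
    by (simp add: mat_mult_four_block mat_one_four_block mat_add_four_block)

  \<comment> \<open>For the other unfolding law the mirrored equations are used, in which
    \<open>f\<close> and \<open>ds\<close> are unfolded at their right ends.\<close>
  have "mat_one r \<boxplus> (f \<boxdot> a \<boxplus> f \<boxdot> (b \<boxdot> ds) \<boxdot> c) = f"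
    using f'(5) by (simp add: dist)
  moreover have "f \<boxdot> b \<boxplus> f \<boxdot> (b \<boxdot> ds) \<boxdot> d = f \<boxdot> (b \<boxdot> ds)"
  proof -
    have "f \<boxdot> (b \<boxdot> ds) = f \<boxdot> (b \<boxdot> (mat_one s \<boxplus> ds \<boxdot> d))"
      by (simp only: ds'(5))
    also have "\<dots> = f \<boxdot> b \<boxplus> f \<boxdot> (b \<boxdot> ds) \<boxdot> d"
      by (simp add: dist)
    finally show ?thesis by simp
  qed
  moreover have "ds \<boxdot> (c \<boxdot> f) \<boxdot> a \<boxplus> (ds \<boxplus> ds \<boxdot> (c \<boxdot> f) \<boxdot> (b \<boxdot> ds)) \<boxdot> c = ds \<boxdot> (c \<boxdot> f)"
  proof -
    have "ds \<boxdot> (c \<boxdot> f) = ds \<boxdot> (c \<boxdot> (mat_one r \<boxplus> f \<boxdot> (a \<boxplus> b \<boxdot> (ds \<boxdot> c))))"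
      by (simp only: f'(5))
    also have "\<dots> = ds \<boxdot> (c \<boxdot> f) \<boxdot> a \<boxplus> (ds \<boxplus> ds \<boxdot> (c \<boxdot> f) \<boxdot> (b \<boxdot> ds)) \<boxdot> c"
      by (simp add: dist mat_add_ac)
    finally show ?thesis by simp
  qed
  moreover have "mat_one s \<boxplus> (ds \<boxdot> (c \<boxdot> f) \<boxdot> b \<boxplus> (ds \<boxplus> ds \<boxdot> (c \<boxdot> f) \<boxdot> (b \<boxdot> ds)) \<boxdot> d) =
      ds \<boxplus> ds \<boxdot> (c \<boxdot> f) \<boxdot> (b \<boxdot> ds)"
  proof -
    let ?Q = "ds \<boxdot> (c \<boxdot> f) \<boxdot> b"
    have "ds \<boxplus> ds \<boxdot> (c \<boxdot> f) \<boxdot> (b \<boxdot> ds) = ds \<boxplus> ?Q \<boxdot> ds"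
      by (simp add: dist)
    also have "\<dots> = (mat_one s \<boxplus> ds \<boxdot> d) \<boxplus> ?Q \<boxdot> (mat_one s \<boxplus> ds \<boxdot> d)"
      by (simp only: ds'(5))
    also have "\<dots> = mat_one s \<boxplus> (?Q \<boxplus> (ds \<boxplus> ds \<boxdot> (c \<boxdot> f) \<boxdot> (b \<boxdot> ds)) \<boxdot> d)"
      by (simp add: dist mat_add_ac)
    finally show ?thesis by simp
  qed
  ultimately have unfold_right: "mat_one (r + s) \<boxplus> ?S \<boxdot> ?A = ?S"
    by (simp add: mat_mult_four_block mat_one_four_block mat_add_four_block)

  \<comment> \<open>Here z is the upper and w the lower part of a block column; the conclusion is
    the claim for both block rows.\<close>
  have left: "f \<boxdot> z \<boxplus> f \<boxdot> (b \<boxdot> ds) \<boxdot> w \<sqsubseteq> z \<and>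
      ds \<boxdot> (c \<boxdot> f) \<boxdot> z \<boxplus> (ds \<boxplus> ds \<boxdot> (c \<boxdot> f) \<boxdot> (b \<boxdot> ds)) \<boxdot> w \<sqsubseteq> w"
    if le: "a \<boxdot> z \<boxplus> b \<boxdot> w \<sqsubseteq> z" "c \<boxdot> z \<boxplus> d \<boxdot> w \<sqsubseteq> w"
      and [simp]: "mat_over K z" "mat_over K w" "dim_row z = r" "dim_row w = s" "dim_col w = dim_col z"
    for z w
  proof -
    have az: "a \<boxdot> z \<sqsubseteq> z" and bw: "b \<boxdot> w \<sqsubseteq> z" and cz: "c \<boxdot> z \<sqsubseteq> w" and dw: "d \<boxdot> w \<sqsubseteq> w"
      using le by (simp_all add: mat_add_le_iff)
    have dsw: "ds \<boxdot> w \<sqsubseteq> w"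
      by (rule ds'(6)) (simp_all add: dw)
    have dscz: "ds \<boxdot> (c \<boxdot> z) \<sqsubseteq> w"
      by (rule mat_le_trans [OF mat_mult_mono_left [OF cz] dsw]) simp_all
    have "b \<boxdot> (ds \<boxdot> (c \<boxdot> z)) \<sqsubseteq> z"
      by (rule mat_le_trans [OF mat_mult_mono_left [OF dscz] bw]) simp_all
    \<comment> \<open>Together with \<open>az\<close> this bounds (a + b ds c) z by z, which is the
      premise of induction for \<open>f\<close>.\<close>
    then have fz: "f \<boxdot> z \<sqsubseteq> z"
      using az by (intro f'(6)) (simp_all add: dist mat_add_le_iff)
    have bdsw: "b \<boxdot> (ds \<boxdot> w) \<sqsubseteq> z"
      by (rule mat_le_trans [OF mat_mult_mono_left [OF dsw] bw]) simp_all
    have fbdsw: "f \<boxdot> (b \<boxdot> (ds \<boxdot> w)) \<sqsubseteq> z"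
      by (rule mat_le_trans [OF mat_mult_mono_left [OF bdsw] fz]) simp_all
    \<comment> \<open>Any x below z is sent below w by ds c. The two products of the lower row that
      contain \<open>f\<close> are the cases x = f z and x = f b ds w.\<close>
    have dsc: "ds \<boxdot> (c \<boxdot> x) \<sqsubseteq> w" if "x \<sqsubseteq> z" "mat_over K x" "dim_row x = r" "dim_col x = dim_col z" for x
      using that
      by (intro mat_le_trans [OF mat_mult_mono_left [OF mat_mult_mono_left [OF \<open>x \<sqsubseteq> z\<close>]] dscz]) simp_all
    show ?thesis
      using fz fbdsw dsw dsc [OF fz] dsc [OF fbdsw]
      by (simp add: dist mat_add_le_iff)
  qed
  have right: "z \<boxdot> f \<boxplus> w \<boxdot> (ds \<boxdot> (c \<boxdot> f)) \<sqsubseteq> z \<and>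
      z \<boxdot> (f \<boxdot> (b \<boxdot> ds)) \<boxplus> w \<boxdot> (ds \<boxplus> ds \<boxdot> (c \<boxdot> f) \<boxdot> (b \<boxdot> ds)) \<sqsubseteq> w"
    if le: "z \<boxdot> a \<boxplus> w \<boxdot> c \<sqsubseteq> z" "z \<boxdot> b \<boxplus> w \<boxdot> d \<sqsubseteq> w"
      and [simp]: "mat_over K z" "mat_over K w" "dim_col z = r" "dim_col w = s" "dim_row w = dim_row z"
    for z w
  proof -
    have za: "z \<boxdot> a \<sqsubseteq> z" and wc: "w \<boxdot> c \<sqsubseteq> z" and zb: "z \<boxdot> b \<sqsubseteq> w" and wd: "w \<boxdot> d \<sqsubseteq> w"
      using le by (simp_all add: mat_add_le_iff)
    have wds: "w \<boxdot> ds \<sqsubseteq> w"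
      by (rule ds'(7)) (simp_all add: wd)
    have zbds: "z \<boxdot> b \<boxdot> ds \<sqsubseteq> w"
      by (rule mat_le_trans [OF mat_mult_mono_right [OF zb] wds]) simp_all
    have "z \<boxdot> b \<boxdot> ds \<boxdot> c \<sqsubseteq> z"
      by (rule mat_le_trans [OF mat_mult_mono_right [OF zbds] wc]) simp_all
    then have zf: "z \<boxdot> f \<sqsubseteq> z"
      using za by (intro f'(7)) (simp_all add: dist mat_add_le_iff)
    have wdsc: "w \<boxdot> ds \<boxdot> c \<sqsubseteq> z"
      by (rule mat_le_trans [OF mat_mult_mono_right [OF wds] wc]) simp_all
    have wdscf: "w \<boxdot> ds \<boxdot> c \<boxdot> f \<sqsubseteq> z"
      by (rule mat_le_trans [OF mat_mult_mono_right [OF wdsc] zf]) simp_all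
    have bds: "x \<boxdot> b \<boxdot> ds \<sqsubseteq> w" if "x \<sqsubseteq> z" "mat_over K x" "dim_col x = r" "dim_row x = dim_row z" for x
      using that
      by (intro mat_le_trans [OF mat_mult_mono_right [OF mat_mult_mono_right [OF \<open>x \<sqsubseteq> z\<close>]] zbds]) simp_all
    show ?thesis
      using zf wdscf wds bds [OF zf] bds [OF wdscf]
      by (simp add: dist mat_add_le_iff)
  qed
  show ?thesis
    unfolding is_asterate_def
  proof (intro conjI allI impI)
    fix Z
    assume Z: "mat_over K Z" "dim_row Z = dim_row ?A" and le: "?A \<boxdot> Z \<sqsubseteq> Z"
    \<comment> \<open>Only the rows need a cut at \<open>r\<close>. As \<open>four_block_mat\<close>
      cuts the columns too, that cut is put at the very end, and \<open>z2\<close> and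
      \<open>w2\<close> have no columns.\<close>
    have "dim_row Z = r + s" "dim_col Z = dim_col Z + 0" using Z by simp_all
    then obtain z1 z2 w1 w2 where Z_eq: "Z = four_block_mat z1 z2 w1 w2"
      and [simp]: "mat_over K z1" "mat_over K z2" "mat_over K w1" "mat_over K w2"
        "dim_row z1 = r" "dim_row z2 = r" "dim_row w1 = s" "dim_row w2 = s"
        "dim_col z1 = dim_col Z" "dim_col z2 = 0" "dim_col w1 = dim_col Z" "dim_col w2 = 0"
      using mat_split [OF Z(1)] by metis
    define p where "p = dim_col Z"
    note [simp] = p_def [symmetric]
    have "four_block_mat (a \<boxdot> z1 \<boxplus> b \<boxdot> w1 \<boxplus> z1) (a \<boxdot> z2 \<boxplus> b \<boxdot> w2 \<boxplus> z2)
        (c \<boxdot> z1 \<boxplus> d \<boxdot> w1 \<boxplus> w1) (c \<boxdot> z2 \<boxplus> d \<boxdot> w2 \<boxplus> w2) = four_block_mat z1 z2 w1 w2"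
      using le unfolding Z_eq by (simp add: mat_mult_four_block mat_add_four_block)
    then have "a \<boxdot> z1 \<boxplus> b \<boxdot> w1 \<sqsubseteq> z1 \<and> a \<boxdot> z2 \<boxplus> b \<boxdot> w2 \<sqsubseteq> z2 \<and>
        c \<boxdot> z1 \<boxplus> d \<boxdot> w1 \<sqsubseteq> w1 \<and> c \<boxdot> z2 \<boxplus> d \<boxdot> w2 \<sqsubseteq> w2"
      by (rule four_block_mat_inject) simp_all
    then show "?S \<boxdot> Z \<sqsubseteq> Z"
      unfolding Z_eq using left [of z1 w1] left [of z2 w2]
      by (simp add: mat_mult_four_block mat_add_four_block)
  next
    fix Z
    assume Z: "mat_over K Z" "dim_col Z = dim_row ?A" and le: "Z \<boxdot> ?A \<sqsubseteq> Z"
    \<comment> \<open>Mirrored: the columns are cut at \<open>r\<close>, and the lower blocks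
      \<open>z2\<close> and \<open>w2\<close> have no rows.\<close>
    have "dim_row Z = dim_row Z + 0" "dim_col Z = r + s" using Z by simp_all
    then obtain z1 w1 z2 w2 where Z_eq: "Z = four_block_mat z1 w1 z2 w2"
      and [simp]: "mat_over K z1" "mat_over K w1" "mat_over K z2" "mat_over K w2"
        "dim_row z1 = dim_row Z" "dim_row w1 = dim_row Z" "dim_row z2 = 0" "dim_row w2 = 0"
        "dim_col z1 = r" "dim_col w1 = s" "dim_col z2 = r" "dim_col w2 = s"
      using mat_split [OF Z(1)] by metis
    define p where "p = dim_row Z"
    note [simp] = p_def [symmetric]
    have "four_block_mat (z1 \<boxdot> a \<boxplus> w1 \<boxdot> c \<boxplus> z1) (z1 \<boxdot> b \<boxplus> w1 \<boxdot> d \<boxplus> w1)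
        (z2 \<boxdot> a \<boxplus> w2 \<boxdot> c \<boxplus> z2) (z2 \<boxdot> b \<boxplus> w2 \<boxdot> d \<boxplus> w2) = four_block_mat z1 w1 z2 w2"
      using le unfolding Z_eq by (simp add: mat_mult_four_block mat_add_four_block)
    then have "z1 \<boxdot> a \<boxplus> w1 \<boxdot> c \<sqsubseteq> z1 \<and> z1 \<boxdot> b \<boxplus> w1 \<boxdot> d \<sqsubseteq> w1 \<and>
        z2 \<boxdot> a \<boxplus> w2 \<boxdot> c \<sqsubseteq> z2 \<and> z2 \<boxdot> b \<boxplus> w2 \<boxdot> d \<sqsubseteq> w2"
      by (rule four_block_mat_inject) simp_all
    then show "Z \<boxdot> ?S \<sqsubseteq> Z"
      unfolding Z_eq using right [of z1 w1] right [of z2 w2]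
      by (simp add: mat_mult_four_block mat_add_four_block)
  qed (use unfold_left unfold_right in simp_all)
qed

lemma is_asterate_mat_star:
  assumes "mat_over K A" "dim_row A = n" "dim_col A = n"
  shows "is_asterate A (mat_star K n A)"
  using assms
proof (induction n arbitrary: A rule: induct_nat_012)
  \<comment> \<open>All matrices in question have no rows or no columns, or are sums over an empty
    index range, so a 0 by 0 matrix is its own asterate.\<close>
  case 0
  then show ?case
    unfolding is_asterate_def by (auto intro!: eq_matI)
next
  case 1
  then show ?case
    using is_asterate_one_by_one [of A] by simp
next
  case (ge2 m)
  obtain a b c d where split: "split_block A 1 1 = (a, b, c, d)"
    by (metis prod_cases4)
  from split_block [OF split, of "Suc m" "Suc m"] ge2.prems
  have dims [simp]: "dim_row a = 1" "dim_col a = 1" "dim_row b = 1" "dim_col b = Suc m"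
      "dim_row c = Suc m" "dim_col c = 1" "dim_row d = Suc m" "dim_col d = Suc m"
    and A: "A = four_block_mat a b c d"
    by auto
  with ge2.prems have over [simp]: "mat_over K a" "mat_over K b" "mat_over K c" "mat_over K d"
    by simp_all
  let ?ds = "mat_star K (Suc m) d"
  have ds: "is_asterate d ?ds"
    using ge2.IH(2) by simp
  note [simp] = is_asterateD(1-3) [OF ds, simplified dims]
  have "is_asterate (a \<boxplus> b \<boxdot> (?ds \<boxdot> c)) (mat_star K (Suc 0) (a \<boxplus> b \<boxdot> (?ds \<boxdot> c)))"
    using is_asterate_one_by_one [of "a \<boxplus> b \<boxdot> (?ds \<boxdot> c)"] by simp
  from is_asterate_four_block [OF over dims ds this]
  show ?case
    using split A by (simp add: Let_def)
qed

end

section \<open>Tensor products in a Morita context\<close>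

context abelian_monoid
begin

text \<open>The guard makes the folded operation commute unconditionally.\<close>

definition msum :: "('z \<Rightarrow> 'a) \<Rightarrow> 'z multiset \<Rightarrow> 'a" where
  "msum f u = fold_mset (\<lambda>z s. if f z \<in> carrier G \<and> s \<in> carrier G then f z \<oplus> s else s) \<zero> u"

lemma msum_empty [simp]: "msum f {#} = \<zero>"
  by (simp add: msum_def)

lemma msum_add_mset_if:
  "msum f (add_mset z u) = (if f z \<in> carrier G \<and> msum f u \<in> carrier G then f z \<oplus> msum f u else msum f u)"
proof -
  interpret comp_fun_commute "\<lambda>z s. if f z \<in> carrier G \<and> s \<in> carrier G then f z \<oplus> s else s"
    by unfold_locales (auto simp: fun_eq_iff a_lcomm)
  show ?thesis
    by (simp add: msum_def)
qed

lemma msum_closed [simp]: "msum f u \<in> carrier G"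
  by (induction u) (simp_all add: msum_add_mset_if)

lemma msum_add_mset [simp]: "f z \<in> carrier G \<Longrightarrow> msum f (add_mset z u) = f z \<oplus> msum f u"
  by (simp add: msum_add_mset_if)

lemma msum_union:
  assumes "\<And>z. z \<in># u \<Longrightarrow> f z \<in> carrier G"
  shows "msum f (u + v) = msum f u \<oplus> msum f v"
  using assms by (induction u) (simp_all add: a_assoc)

end

lemma formal_sums_simps [simp]:
  "{#} \<in> formal_sums X Y"
  "add_mset (x, y) u \<in> formal_sums X Y \<longleftrightarrow> x \<in> carrier X \<and> y \<in> carrier Y \<and> u \<in> formal_sums X Y"
  "u + v \<in> formal_sums X Y \<longleftrightarrow> u \<in> formal_sums X Y \<and> v \<in> formal_sums X Y"
  by (auto simp: formal_sums_def)

text \<open>The locale is one-sided: it serves to compare the tensor product of \<open>X\<close> and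
  \<open>Y\<close> over \<open>B\<close> with \<open>R\<close>. The other tensor product comes from
  a second interpretation with the roles exchanged. The laws \<open>\<phi>_\<psi>\<close> and
  \<open>\<psi>_\<phi>\<close> are the mixed associativities (x y) x' = x (y x') and (y x) y' = y (x
  y').\<close>

locale morita_context =
  R: semiring R + B: semiring B + X: bimodule R B X + Y: bimodule B R Y
  for R :: "('r, 'm1) ring_scheme" and B :: "('b, 'm2) ring_scheme"
    and X :: "('r, 'x, 'b, 'm3) bimodule_scheme" and Y :: "('b, 'y, 'r, 'm4) bimodule_scheme" +
  fixes \<phi> :: "'x \<Rightarrow> 'y \<Rightarrow> 'r" and \<psi> :: "'y \<Rightarrow> 'x \<Rightarrow> 'b"
  assumes \<phi>_closed: "\<lbrakk>x \<in> carrier X; y \<in> carrier Y\<rbrakk> \<Longrightarrow> \<phi> x y \<in> carrier R"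
    and \<phi>_add_left: "\<lbrakk>x \<in> carrier X; x' \<in> carrier X; y \<in> carrier Y\<rbrakk>
      \<Longrightarrow> \<phi> (x \<oplus>\<^bsub>X\<^esub> x') y = \<phi> x y \<oplus>\<^bsub>R\<^esub> \<phi> x' y"
    and \<phi>_add_right: "\<lbrakk>x \<in> carrier X; y \<in> carrier Y; y' \<in> carrier Y\<rbrakk>
      \<Longrightarrow> \<phi> x (y \<oplus>\<^bsub>Y\<^esub> y') = \<phi> x y \<oplus>\<^bsub>R\<^esub> \<phi> x y'"
    and \<phi>_zero_left: "y \<in> carrier Y \<Longrightarrow> \<phi> \<zero>\<^bsub>X\<^esub> y = \<zero>\<^bsub>R\<^esub>"
    and \<phi>_zero_right: "x \<in> carrier X \<Longrightarrow> \<phi> x \<zero>\<^bsub>Y\<^esub> = \<zero>\<^bsub>R\<^esub>"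
    and \<phi>_balanced: "\<lbrakk>x \<in> carrier X; b \<in> carrier B; y \<in> carrier Y\<rbrakk>
      \<Longrightarrow> \<phi> (ract X x b) y = \<phi> x (lact Y b y)"
    and \<phi>_lact: "\<lbrakk>r \<in> carrier R; x \<in> carrier X; y \<in> carrier Y\<rbrakk>
      \<Longrightarrow> \<phi> (lact X r x) y = r \<otimes>\<^bsub>R\<^esub> \<phi> x y"
    and \<phi>_ract: "\<lbrakk>x \<in> carrier X; y \<in> carrier Y; r \<in> carrier R\<rbrakk>
      \<Longrightarrow> \<phi> x (ract Y y r) = \<phi> x y \<otimes>\<^bsub>R\<^esub> r"
    and \<psi>_closed: "\<lbrakk>y \<in> carrier Y; x \<in> carrier X\<rbrakk> \<Longrightarrow> \<psi> y x \<in> carrier B"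
    and \<phi>_\<psi>: "\<lbrakk>x \<in> carrier X; y \<in> carrier Y; x' \<in> carrier X\<rbrakk>
      \<Longrightarrow> lact X (\<phi> x y) x' = ract X x (\<psi> y x')"
    and \<psi>_\<phi>: "\<lbrakk>y \<in> carrier Y; x \<in> carrier X; y' \<in> carrier Y\<rbrakk>
      \<Longrightarrow> lact Y (\<psi> y x) y' = ract Y y (\<phi> x y')"
begin

abbreviation tcong :: "('x \<times> 'y) multiset rel" where
  "tcong \<equiv> tensor_cong B X Y"

abbreviation cls :: "('x \<times> 'y) multiset \<Rightarrow> ('x \<times> 'y) multiset set" where
  "cls u \<equiv> tcong `` {u}"

definition ev :: "('x \<times> 'y) multiset \<Rightarrow> 'r" where
  "ev = R.msum (\<lambda>(x, y). \<phi> x y)"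

lemma ev_closed [simp]: "ev u \<in> carrier R"
  by (simp add: ev_def)

lemma ev_empty [simp]: "ev {#} = \<zero>\<^bsub>R\<^esub>"
  by (simp add: ev_def)

lemma ev_add_mset [simp]:
  "\<lbrakk>x \<in> carrier X; y \<in> carrier Y\<rbrakk> \<Longrightarrow> ev (add_mset (x, y) u) = \<phi> x y \<oplus>\<^bsub>R\<^esub> ev u"
  by (simp add: ev_def \<phi>_closed)

lemma ev_union: "u \<in> formal_sums X Y \<Longrightarrow> ev (u + v) = ev u \<oplus>\<^bsub>R\<^esub> ev v"
  unfolding ev_def by (rule R.msum_union) (auto simp: formal_sums_def \<phi>_closed)

lemma formal_sums_induct [consumes 1, case_names empty add]:
  assumes "u \<in> formal_sums X Y" "P {#}"
    "\<And>x y u. \<lbrakk>x \<in> carrier X; y \<in> carrier Y; u \<in> formal_sums X Y; P u\<rbrakk> \<Longrightarrow> P (add_mset (x, y) u)"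
  shows "P u"
  using assms(1)
proof (induction u)
  case empty
  show ?case by (fact assms(2))
next
  case (add z u)
  then show ?case
    using assms(3) by (cases z) simp
qed

lemma lact_formal_sum:
  assumes "u \<in> formal_sums X Y" "r \<in> carrier R"
  shows "image_mset (\<lambda>(x, y). (lact X r x, y)) u \<in> formal_sums X Y"
    and "ev (image_mset (\<lambda>(x, y). (lact X r x, y)) u) = r \<otimes>\<^bsub>R\<^esub> ev u"
proof -
  show "image_mset (\<lambda>(x, y). (lact X r x, y)) u \<in> formal_sums X Y"
    using assms by (induction u rule: formal_sums_induct) (simp_all add: X.left.act_closed)
  show "ev (image_mset (\<lambda>(x, y). (lact X r x, y)) u) = r \<otimes>\<^bsub>R\<^esub> ev u"
    using assms
    by (induction u rule: formal_sums_induct)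
      (simp_all add: X.left.act_closed \<phi>_lact \<phi>_closed R.r_distr)
qed

lemma ract_formal_sum:
  assumes "u \<in> formal_sums X Y" "r \<in> carrier R"
  shows "image_mset (\<lambda>(x, y). (x, ract Y y r)) u \<in> formal_sums X Y"
    and "ev (image_mset (\<lambda>(x, y). (x, ract Y y r)) u) = ev u \<otimes>\<^bsub>R\<^esub> r"
proof -
  show "image_mset (\<lambda>(x, y). (x, ract Y y r)) u \<in> formal_sums X Y"
    using assms by (induction u rule: formal_sums_induct) (simp_all add: Y.right.act_closed)
  show "ev (image_mset (\<lambda>(x, y). (x, ract Y y r)) u) = ev u \<otimes>\<^bsub>R\<^esub> r"
    using assms
    by (induction u rule: formal_sums_induct)
      (simp_all add: Y.right.act_closed \<phi>_ract \<phi>_closed R.l_distr)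
qed

text \<open>Each generating pair of the congruence is respected because \<phi> is biadditive and
  balanced, so \<open>ev\<close> descends to the tensor product.\<close>

lemma tensor_cong_imp_ev_eq:
  "(u, v) \<in> tcong \<Longrightarrow> u \<in> formal_sums X Y \<and> v \<in> formal_sums X Y \<and> ev u = ev v"
  by (induction rule: tensor_cong.induct)
    (simp_all add: ev_union \<phi>_closed \<phi>_add_left \<phi>_add_right \<phi>_zero_left \<phi>_zero_right \<phi>_balanced
      X.right.act_closed Y.left.act_closed)

section \<open>Inverting evaluation, given a formal sum that evaluates to one\<close>

context
  fixes w :: "('x \<times> 'y) multiset"
  assumes w: "w \<in> formal_sums X Y" "ev w = \<one>\<^bsub>R\<^esub>"
begin

definition lift :: "'r \<Rightarrow> ('x \<times> 'y) multiset" where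
  "lift r = image_mset (\<lambda>(x, y). (lact X r x, y)) w"

lemma lift_formal_sum: "r \<in> carrier R \<Longrightarrow> lift r \<in> formal_sums X Y"
  and ev_lift: "r \<in> carrier R \<Longrightarrow> ev (lift r) = r"
  using lact_formal_sum [OF w(1)] w(2) by (simp_all add: lift_def)

lemma lift_zero: "(lift \<zero>\<^bsub>R\<^esub>, {#}) \<in> tcong"
  unfolding lift_def using w(1)
proof (induction w rule: formal_sums_induct)
  case empty
  show ?case by (simp add: tensor_cong.refl)
next
  case (add x y u)
  from tensor_cong.plus [OF tensor_cong.zero_left [OF add(2)] add.IH] add(1) show ?case
    by (simp add: X.left.act_zero)
qed

text \<open>In general the right-hand multiset has twice as many pairs as the left-hand one, so the
  two sides agree only modulo the congruence, pair by pair through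
  \<open>tensor_cong.add_left\<close>.\<close>

lemma lift_add:
  assumes r: "r \<in> carrier R" "s \<in> carrier R"
  shows "(lift (r \<oplus>\<^bsub>R\<^esub> s), lift r + lift s) \<in> tcong"
  unfolding lift_def using w(1)
proof (induction w rule: formal_sums_induct)
  case empty
  show ?case by (simp add: tensor_cong.refl)
next
  case (add x y u)
  have "({#(lact X r x \<oplus>\<^bsub>X\<^esub> lact X s x, y)#}, {#(lact X r x, y), (lact X s x, y)#}) \<in> tcong"
    using add(1,2) r by (intro tensor_cong.add_left) (simp_all add: X.left.act_closed)
  from tensor_cong.plus [OF this add.IH] add(1) r show ?case
    by (simp add: X.left.act_add_left add_mset_commute)
qed

lemma lift_pair:
  assumes x: "x \<in> carrier X" and y: "y \<in> carrier Y"
  shows "(lift (\<phi> x y), {#(x, y)#}) \<in> tcong"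
proof -
  \<comment> \<open>Replacing y by y acted on by \<open>ev w\<close> removes the assumption that
    \<open>w\<close> evaluates to one, so that induction over \<open>w\<close> is possible.\<close>
  have "(image_mset (\<lambda>(a, b). (lact X (\<phi> x y) a, b)) w, {#(x, ract Y y (ev w))#}) \<in> tcong"
    using w(1)
  proof (induction w rule: formal_sums_induct)
    case empty
    show ?case
      using tensor_cong.sym [OF tensor_cong.zero_right [OF x]] y by (simp add: Y.right.act_zero)
  next
    case (add a b u)
    \<comment> \<open>The decisive move: \<psi> y a lies in \<open>B\<close> and may cross the
      tensor sign. The two mixed associativities then rewrite both ends.\<close>
    have "({#(ract X x (\<psi> y a), b)#}, {#(x, lact Y (\<psi> y a) b)#}) \<in> tcong"
      using add(1,2) x y by (intro tensor_cong.balanced) (simp_all add: \<psi>_closed)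
    then have "({#(lact X (\<phi> x y) a, b)#}, {#(x, ract Y y (\<phi> a b))#}) \<in> tcong"
      using add(1,2) x y by (simp add: \<phi>_\<psi> \<psi>_\<phi>)
    from tensor_cong.plus [OF this add.IH]
    have "(image_mset (\<lambda>(a, b). (lact X (\<phi> x y) a, b)) (add_mset (a, b) u),
        {#(x, ract Y y (\<phi> a b)), (x, ract Y y (ev u))#}) \<in> tcong"
      by (simp add: add_mset_commute)
    \<comment> \<open>Both pairs have first component x, so they merge into one and the right-hand
      side keeps the shape required by the induction.\<close>
    also have "({#(x, ract Y y (\<phi> a b)), (x, ract Y y (ev u))#},
        {#(x, ract Y y (\<phi> a b) \<oplus>\<^bsub>Y\<^esub> ract Y y (ev u))#}) \<in> tcong"
      using add(1,2) x y
      by (intro tensor_cong.sym [OF tensor_cong.add_right]) (simp_all add: Y.right.act_closed \<phi>_closed)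
    finally (tensor_cong.trans) show ?case
      using add(1,2) y by (simp add: Y.right.act_add_right \<phi>_closed)
  qed
  then show ?thesis
    using w(2) y by (simp add: lift_def Y.right.act_one)
qed

lemma lift_ev: "u \<in> formal_sums X Y \<Longrightarrow> (lift (ev u), u) \<in> tcong"
proof (induction u rule: formal_sums_induct)
  case empty
  then show ?case by (simp add: lift_zero)
next
  case (add x y u)
  have "(lift (\<phi> x y \<oplus>\<^bsub>R\<^esub> ev u), lift (\<phi> x y) + lift (ev u)) \<in> tcong"
    using add by (simp add: lift_add \<phi>_closed)
  also have "(lift (\<phi> x y) + lift (ev u), {#(x, y)#} + u) \<in> tcong"
    using add by (intro tensor_cong.plus lift_pair)
  finally (tensor_cong.trans) show ?case
    using add by simp
qed

text \<open>The congruence is the kernel of \<open>ev\<close>: sums with the same value are both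
  congruent to the \<open>lift\<close> of that value.\<close>

lemma tensor_cong_iff:
  "(u, v) \<in> tcong \<longleftrightarrow> u \<in> formal_sums X Y \<and> v \<in> formal_sums X Y \<and> ev u = ev v"
proof
  assume "u \<in> formal_sums X Y \<and> v \<in> formal_sums X Y \<and> ev u = ev v"
  then have "(u, lift (ev u)) \<in> tcong" "(lift (ev u), v) \<in> tcong"
    using lift_ev [of u] lift_ev [of v] by (auto intro: tensor_cong.sym)
  then show "(u, v) \<in> tcong"
    by (rule tensor_cong.trans)
qed (rule tensor_cong_imp_ev_eq)

lemma cls_eq: "u \<in> formal_sums X Y \<Longrightarrow> cls u = {v \<in> formal_sums X Y. ev v = ev u}"
  by (auto simp: tensor_cong_iff)

lemma tensor_carrier: "carrier (tensor_product B X Y) = cls ` formal_sums X Y"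
  by (auto simp: tensor_product_def quotient_def)

lemma tensor_add:
  assumes "u \<in> formal_sums X Y" "v \<in> formal_sums X Y"
  shows "cls u \<oplus>\<^bsub>tensor_product B X Y\<^esub> cls v = cls (u + v)"
proof -
  \<comment> \<open>The union over representatives collapses because every member of it is the same
    class and the index sets are nonempty. The two actions are treated likewise.\<close>
  have "cls (u' + v') = cls (u + v)" if "u' \<in> cls u" "v' \<in> cls v" for u' v'
    using assms that by (simp add: cls_eq ev_union)
  moreover have "u \<in> cls u" "v \<in> cls v"
    using assms by (simp_all add: cls_eq)
  ultimately show ?thesis
    unfolding tensor_product_def ring.simps by blast
qed

lemma tensor_lact:
  assumes "u \<in> formal_sums X Y" "r \<in> carrier R"
  shows "lact (tensor_product B X Y) r (cls u) = cls (image_mset (\<lambda>(x, y). (lact X r x, y)) u)"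
proof -
  have "cls (image_mset (\<lambda>(x, y). (lact X r x, y)) u') = cls (image_mset (\<lambda>(x, y). (lact X r x, y)) u)"
    if "u' \<in> cls u" for u'
    using assms that by (simp add: cls_eq lact_formal_sum)
  moreover have "u \<in> cls u"
    using assms by (simp add: cls_eq)
  ultimately show ?thesis
    unfolding tensor_product_def bimodule.simps by blast
qed

lemma tensor_ract:
  assumes "u \<in> formal_sums X Y" "r \<in> carrier R"
  shows "ract (tensor_product B X Y) (cls u) r = cls (image_mset (\<lambda>(x, y). (x, ract Y y r)) u)"
proof -
  have "cls (image_mset (\<lambda>(x, y). (x, ract Y y r)) u') = cls (image_mset (\<lambda>(x, y). (x, ract Y y r)) u)"
    if "u' \<in> cls u" for u'
    using assms that by (simp add: cls_eq ract_formal_sum)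
  moreover have "u \<in> cls u"
    using assms by (simp add: cls_eq)
  ultimately show ?thesis
    unfolding tensor_product_def bimodule.simps by blast
qed

lemma tensor_product_iso_regular:
  "bimodule_iso R R (tensor_product B X Y) (regular_bimodule R)"
proof -
  \<comment> \<open>The choice of representative is harmless, since \<open>ev\<close> is constant on
    a class.\<close>
  define h where "h U = ev (SOME u. u \<in> U)" for U
  have h: "h (cls u) = ev u" if "u \<in> formal_sums X Y" for u
  proof -
    have "u \<in> cls u"
      using that by (simp add: cls_eq)
    then have "(SOME u'. u' \<in> cls u) \<in> cls u"
      by (rule someI)
    then show ?thesis
      using that by (simp add: h_def cls_eq)
  qed
  have cls_eqI: "cls u = cls v" if "u \<in> formal_sums X Y" "v \<in> formal_sums X Y" "ev u = ev v" for u v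
    using that by (simp add: cls_eq)
  have "h \<in> bimodule_hom R R (tensor_product B X Y) (regular_bimodule R)"
    by (auto simp: bimodule_hom_def tensor_carrier tensor_add tensor_lact tensor_ract h
        lact_formal_sum ract_formal_sum ev_union regular_bimodule_def)
  moreover have "(\<lambda>r. cls (lift r)) \<in> bimodule_hom R R (regular_bimodule R) (tensor_product B X Y)"
  proof -
    \<comment> \<open>By \<open>cls_eqI\<close> these laws only require equal values under
      \<open>ev\<close>, although the multisets themselves may differ.\<close>
    have "cls (lift (r \<oplus>\<^bsub>R\<^esub> s)) = cls (lift r + lift s)"
      "cls (lift (r \<otimes>\<^bsub>R\<^esub> s)) = cls (image_mset (\<lambda>(x, y). (lact X r x, y)) (lift s))"
      "cls (lift (r \<otimes>\<^bsub>R\<^esub> s)) = cls (image_mset (\<lambda>(x, y). (x, ract Y y s)) (lift r))"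
      if "r \<in> carrier R" "s \<in> carrier R" for r s
      by (rule cls_eqI; use that in \<open>simp add: lact_formal_sum ract_formal_sum ev_union
          lift_formal_sum ev_lift\<close>)+
    then show ?thesis
      unfolding bimodule_hom_def regular_bimodule_def
      by (auto simp: tensor_carrier tensor_add tensor_lact tensor_ract lift_formal_sum
          simp del: Image_singleton_iff)
  qed
  moreover have "cls (lift (h U)) = U" if "U \<in> carrier (tensor_product B X Y)" for U
  proof -
    from that obtain u where u: "u \<in> formal_sums X Y" "U = cls u"
      by (auto simp: tensor_carrier)
    then have "cls (lift (ev u)) = cls u"
      by (intro cls_eqI) (simp_all add: lift_formal_sum ev_lift)
    with u show ?thesis
      by (simp add: h)
  qed
  moreover have "h (cls (lift r)) = r" if "r \<in> carrier (regular_bimodule R)" for r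
    using that by (simp add: regular_bimodule_def h lift_formal_sum ev_lift)
  ultimately show ?thesis
    unfolding bimodule_iso_def
    by (intro bexI [of _ h] bexI [of _ "\<lambda>r. cls (lift r)"] conjI ballI)
qed

end

end

section \<open>Rows and columns\<close>

definition mats :: "('a, 'm) ring_scheme \<Rightarrow> nat \<Rightarrow> nat \<Rightarrow> 'a mat set" where
  "mats K r c = {A. mat_over K A \<and> dim_row A = r \<and> dim_col A = c}"

lemma mats_iff [simp]: "A \<in> mats K r c \<longleftrightarrow> mat_over K A \<and> dim_row A = r \<and> dim_col A = c"
  by (simp add: mats_def)

lemma mat_kleene_algebra_simps [simp]:
  "carrier (mat_kleene_algebra n K) = mats K n n"
  "mult (mat_kleene_algebra n K) = mat_mult K"
  "add (mat_kleene_algebra n K) = mat_add K"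
  "one (mat_kleene_algebra n K) = mat n n (\<lambda>(i, j). if i = j then \<one>\<^bsub>K\<^esub> else \<zero>\<^bsub>K\<^esub>)"
  "zero (mat_kleene_algebra n K) = mat n n (\<lambda>_. \<zero>\<^bsub>K\<^esub>)"
  "star (mat_kleene_algebra n K) = mat_star K n"
  by (auto simp: mat_kleene_algebra_def mat_over_def)

context kleene_algebra
begin

section \<open>Square matrices form a Kleene algebra\<close>

lemma kleene_algebra_mat: "kleene_algebra (mat_kleene_algebra n K)" (is "kleene_algebra ?M")
proof -
  have "abelian_monoid ?M"
    by (rule abelian_monoidI) (auto simp: mat_add_ac)
  moreover have "monoid ?M"
    by (rule monoidI) (auto simp: mat_mult_assoc)
  ultimately have "semiring ?M"
    by (intro semiring.intro semiring_axioms.intro)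
      (simp_all add: mat_mult_distrib_left mat_mult_distrib_right)
  moreover have "kleene_algebra_axioms ?M"
  proof (unfold_locales, goal_cases)
    case (1 x)
    then show ?case
      using is_asterateD(1-3) [OF is_asterate_mat_star, of x n] by simp
  next
    case (2 x)
    then show ?case
      by (simp add: mat_add_idem)
  next
    case (3 x)
    then show ?case
      using is_asterateD(4) [OF is_asterate_mat_star, of x n] by simp
  next
    case (4 x)
    then show ?case
      using is_asterateD(5) [OF is_asterate_mat_star, of x n] by simp
  next
    case (5 x y z)
    then have [simp]: "mat_over K x" "mat_over K y" "mat_over K z" "dim_row x = n" "dim_row y = n"
      "dim_row z = n" "dim_col x = n" "dim_col y = n" "dim_col z = n"
      by simp_all
    note S = is_asterateD [OF is_asterate_mat_star [of y n], simplified]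
    note [simp] = S(1-3)
    \<comment> \<open>The premise splits into x <= z and yz <= z; then y* x <= y* z <= z by
      monotonicity and induction.\<close>
    from 5 have le: "x \<sqsubseteq> z" "y \<boxdot> z \<sqsubseteq> z"
      by (simp_all add: add_le_def mat_add_le_iff)
    have "mat_star K n y \<boxdot> x \<sqsubseteq> z"
      by (rule mat_le_trans [OF mat_mult_mono_left [OF le(1)] S(6) [OF _ _ le(2)]]) simp_all
    then show ?case
      by (simp add: add_le_def)
  next
    case (6 x y z)
    then have [simp]: "mat_over K x" "mat_over K y" "mat_over K z" "dim_row x = n" "dim_row y = n"
      "dim_row z = n" "dim_col x = n" "dim_col y = n" "dim_col z = n"
      by simp_all
    note S = is_asterateD [OF is_asterate_mat_star [of y n], simplified]
    note [simp] = S(1-3)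
    from 6 have le: "x \<sqsubseteq> z" "z \<boxdot> y \<sqsubseteq> z"
      by (simp_all add: add_le_def mat_add_le_iff)
    have "x \<boxdot> mat_star K n y \<sqsubseteq> z"
      by (rule mat_le_trans [OF mat_mult_mono_right [OF le(1)] S(7) [OF _ _ le(2)]]) simp_all
    then show ?case
      by (simp add: add_le_def)
  qed
  ultimately show ?thesis
    by (rule kleene_algebra.intro)
qed

section \<open>Rectangular matrices as Kleene bimodules\<close>

text \<open>
  Treating \<open>K\<close> as the \<open>1 \<times> 1\<close> matrices makes both scalar actions on rectangular matrices instances
  of matrix multiplication.
\<close>

definition mat_iso :: "('s, 'r) kleene_algebra_scheme \<Rightarrow> nat \<Rightarrow> ('s \<Rightarrow> 'a mat) \<Rightarrow> bool" where
  "mat_iso S p f \<longleftrightarrow>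
     kleene_algebra S \<and> bij_betw f (carrier S) (mats K p p) \<and>
     (\<forall>s\<in>carrier S. \<forall>t\<in>carrier S. f (s \<oplus>\<^bsub>S\<^esub> t) = f s \<boxplus> f t \<and> f (s \<otimes>\<^bsub>S\<^esub> t) = f s \<boxdot> f t) \<and>
     f \<zero>\<^bsub>S\<^esub> = mat_zero p p \<and> f \<one>\<^bsub>S\<^esub> = mat_one p \<and>
     (\<forall>s\<in>carrier S. is_asterate (f s) (f (s\<^sup>\<star>\<^bsub>S\<^esub>)))"

lemma mat_iso_id: "mat_iso (mat_kleene_algebra n K) n (\<lambda>A. A)"
  using kleene_algebra_mat is_asterate_mat_star by (simp add: mat_iso_def bij_betw_def)

lemma mat_iso_scalar: "mat_iso K 1 (\<lambda>k. mat 1 1 (\<lambda>_. k))"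
proof -
  have over: "mat_over K (mat 1 1 (\<lambda>_. k))" if "k \<in> carrier K" for k
    using that by (intro mat_overI) simp
  have "is_asterate (mat 1 1 (\<lambda>_. k)) (mat 1 1 (\<lambda>_. k\<^sup>\<star>))" if "k \<in> carrier K" for k
  proof -
    have "map_mat (star K) (mat 1 1 (\<lambda>_. k)) = mat 1 1 (\<lambda>_. k\<^sup>\<star>)"
      by (intro eq_matI) simp_all
    with is_asterate_one_by_one [OF over [OF that]] show ?thesis
      by simp
  qed
  moreover have "bij_betw (\<lambda>k. mat 1 1 (\<lambda>_. k)) (carrier K) (mats K 1 1)"
    by (rule bij_betw_byWitness [where f' = "\<lambda>A. A $$ (0, 0)"])
      (auto simp: over [simplified] intro!: eq_matI)
  moreover have "kleene_algebra K" ..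
  ultimately show ?thesis
    unfolding mat_iso_def by (auto intro!: eq_matI simp: finsum_lessThan_one)
qed

text \<open>With (p, q) = (1, n) these are the rows and with (n, 1) the columns. Scalars act through
  their matrix images under \<open>f\<close> and \<open>g\<close>, which lets one proof serve both
  bimodules.\<close>

definition mat_bimodule ::
    "nat \<Rightarrow> nat \<Rightarrow> ('s \<Rightarrow> 'a mat) \<Rightarrow> ('t \<Rightarrow> 'a mat) \<Rightarrow> ('s, 'a mat, 't) bimodule" where
  "mat_bimodule p q f g =
     \<lparr>carrier = mats K p q, mult = undefined, one = undefined, zero = mat_zero p q, add = mat_add K,
      lact = (\<lambda>s A. f s \<boxdot> A), ract = (\<lambda>A t. A \<boxdot> g t)\<rparr>"

lemma mat_bimodule_simps [simp]:
  "carrier (mat_bimodule p q f g) = mats K p q"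
  "zero (mat_bimodule p q f g) = mat_zero p q"
  "add (mat_bimodule p q f g) = mat_add K"
  "lact (mat_bimodule p q f g) s A = f s \<boxdot> A"
  "ract (mat_bimodule p q f g) A t = A \<boxdot> g t"
  by (simp_all add: mat_bimodule_def)

context
  fixes S :: "('s, 'r) kleene_algebra_scheme" and T :: "('t, 'u) kleene_algebra_scheme"
    and p q :: nat and f :: "'s \<Rightarrow> 'a mat" and g :: "'t \<Rightarrow> 'a mat"
  assumes f: "mat_iso S p f" and g: "mat_iso T q g"
begin

lemma mat_iso_carrier [simp]:
  "s \<in> carrier S \<Longrightarrow> mat_over K (f s) \<and> dim_row (f s) = p \<and> dim_col (f s) = p"
  "t \<in> carrier T \<Longrightarrow> mat_over K (g t) \<and> dim_row (g t) = q \<and> dim_col (g t) = q"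
  using f g by (auto simp: mat_iso_def dest!: bij_betw_apply)

lemma mat_iso_hom [simp]:
  "\<lbrakk>s \<in> carrier S; s' \<in> carrier S\<rbrakk> \<Longrightarrow> f (s \<oplus>\<^bsub>S\<^esub> s') = f s \<boxplus> f s'"
  "\<lbrakk>s \<in> carrier S; s' \<in> carrier S\<rbrakk> \<Longrightarrow> f (s \<otimes>\<^bsub>S\<^esub> s') = f s \<boxdot> f s'"
  "f \<zero>\<^bsub>S\<^esub> = mat_zero p p" "f \<one>\<^bsub>S\<^esub> = mat_one p"
  "\<lbrakk>t \<in> carrier T; t' \<in> carrier T\<rbrakk> \<Longrightarrow> g (t \<oplus>\<^bsub>T\<^esub> t') = g t \<boxplus> g t'"
  "\<lbrakk>t \<in> carrier T; t' \<in> carrier T\<rbrakk> \<Longrightarrow> g (t \<otimes>\<^bsub>T\<^esub> t') = g t \<boxdot> g t'"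
  "g \<zero>\<^bsub>T\<^esub> = mat_zero q q" "g \<one>\<^bsub>T\<^esub> = mat_one q"
  using f g by (auto simp: mat_iso_def)

lemma kleene_bimodule_mat: "kleene_bimodule S T (mat_bimodule p q f g)"
proof -
  interpret S: kleene_algebra S using f by (simp add: mat_iso_def)
  interpret T: kleene_algebra T using g by (simp add: mat_iso_def)
  interpret X: abelian_monoid "mat_bimodule p q f g"
    by (rule abelian_monoidI) (auto simp: mat_add_ac)
  have star_f: "is_asterate (f s) (f (s\<^sup>\<star>\<^bsub>S\<^esub>))" if "s \<in> carrier S" for s
    using f that by (auto simp: mat_iso_def)
  have star_g: "is_asterate (g t) (g (t\<^sup>\<star>\<^bsub>T\<^esub>))" if "t \<in> carrier T" for t
    using g that by (auto simp: mat_iso_def)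
  show ?thesis
    by unfold_locales
      (auto simp: mat_mult_distrib_left mat_mult_distrib_right mat_mult_assoc add_le_def
        intro: is_asterateD(6) [OF star_f] is_asterateD(7) [OF star_g])
qed

end

text \<open>The identity E_k0 E_0k = E_kk for matrix units. The middle index 0 exists because
  \<open>q\<close> is positive.\<close>

lemma mat_units_mult:
  assumes "k < p" "0 < q"
  shows "mat p q (\<lambda>(i, j). if i = k \<and> j = 0 then \<one> else \<zero>) \<boxdot>
      mat q p (\<lambda>(i, j). if i = 0 \<and> j = k then \<one> else \<zero>) =
    mat p p (\<lambda>(i, j). if i = k \<and> j = k then \<one> else \<zero>)" (is "?A \<boxdot> ?B = ?C")
proof (rule eq_matI)
  fix i j
  assume "i < dim_row ?C" "j < dim_col ?C"
  then have ij: "i < p" "j < p" by simp_all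
  have "(?A \<boxdot> ?B) $$ (i, j) = (\<Oplus>l\<in>{..<q}. ?A $$ (i, l) \<otimes> ?B $$ (l, j))"
    using ij by simp
  also have "\<dots> = (\<Oplus>l\<in>{..<q}. if l = 0 then if i = k \<and> j = k then \<one> else \<zero> else \<zero>)"
    using ij by (intro finsum_cong') auto
  also have "\<dots> = (if i = k \<and> j = k then \<one> else \<zero>)"
    using assms by (intro finsum_delta(2) [where f = "\<lambda>_. if i = k \<and> j = k then \<one> else \<zero>"]) auto
  finally show "(?A \<boxdot> ?B) $$ (i, j) = ?C $$ (i, j)"
    using ij by simp
qed simp_all

lemma mat_tensor_product_iso_regular:
  fixes S :: "('s, 'r) kleene_algebra_scheme" and T :: "('t, 'u) kleene_algebra_scheme"
  assumes f: "mat_iso S p f" and g: "mat_iso T q g" and q: "0 < q"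
  shows "bimodule_iso S S (tensor_product T (mat_bimodule p q f g) (mat_bimodule q p g f))
    (regular_bimodule S)"
proof -
  have bij: "bij_betw f (carrier S) (mats K p p)" "bij_betw g (carrier T) (mats K q q)"
    using f g unfolding mat_iso_def by blast+
  interpret X: kleene_bimodule S T "mat_bimodule p q f g"
    using f g by (rule kleene_bimodule_mat)
  interpret Y: kleene_bimodule T S "mat_bimodule q p g f"
    using g f by (rule kleene_bimodule_mat)
  note [simp] = mat_iso_carrier [OF f g] mat_iso_hom [OF f g]
  \<comment> \<open>The pairings are matrix products pulled back along the bijections
    \<open>f\<close> and \<open>g\<close>, so that they take values in \<open>S\<close> and
    \<open>T\<close> rather than in matrices.\<close>
  define \<phi> where "\<phi> x y = the_inv_into (carrier S) f (x \<boxdot> y)" for x y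
  define \<psi> where "\<psi> y x = the_inv_into (carrier T) g (y \<boxdot> x)" for y x
  have \<phi>: "\<phi> x y \<in> carrier S" "f (\<phi> x y) = x \<boxdot> y" if "x \<in> mats K p q" "y \<in> mats K q p" for x y
  proof -
    have "x \<boxdot> y \<in> mats K p p"
      using that by simp
    with bij(1) show "\<phi> x y \<in> carrier S" "f (\<phi> x y) = x \<boxdot> y"
      unfolding \<phi>_def bij_betw_def by (metis subset_refl the_inv_into_into f_the_inv_into_f)+
  qed
  have \<psi>: "\<psi> y x \<in> carrier T" "g (\<psi> y x) = y \<boxdot> x" if "x \<in> mats K p q" "y \<in> mats K q p" for x y
  proof -
    have "y \<boxdot> x \<in> mats K q q"
      using that by simp
    with bij(2) show "\<psi> y x \<in> carrier T" "g (\<psi> y x) = y \<boxdot> x"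
      unfolding \<psi>_def bij_betw_def by (metis subset_refl the_inv_into_into f_the_inv_into_f)+
  qed
  have f_inject: "s = t" if "f s = f t" "s \<in> carrier S" "t \<in> carrier S" for s t
    using bij(1) that by (auto simp: bij_betw_def inj_on_def)
  \<comment> \<open>Equations in \<open>S\<close> are checked after applying \<open>f\<close>; both
    mixed associativities become associativity of a product of three matrices.\<close>
  interpret morita_context S T "mat_bimodule p q f g" "mat_bimodule q p g f" \<phi> \<psi>
    by unfold_locales
      (auto intro!: f_inject simp: \<phi> \<psi> mat_mult_assoc mat_mult_distrib_left mat_mult_distrib_right)
  define U where "U k = mat p q (\<lambda>(i, j). if i = k \<and> j = 0 then \<one> else \<zero>)" for k
  define V where "V k = mat q p (\<lambda>(i, j). if i = 0 \<and> j = k then \<one> else \<zero>)" for k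
  define w where "w k = image_mset (\<lambda>l. (U l, V l)) (mset_set {..<k})" for k
  have UV: "U k \<in> mats K p q" "V k \<in> mats K q p" for k
    by (auto simp: U_def V_def intro!: mat_overI)
  have w: "w k \<in> formal_sums (mat_bimodule p q f g) (mat_bimodule q p g f)" for k
    using UV by (auto simp: w_def formal_sums_def)
  \<comment> \<open>The partial sum of the first k diagonal units. At k = p it is the identity
    matrix, hence \<open>w p\<close> evaluates to one.\<close>
  have ev_w: "f (ev (w k)) = mat p p (\<lambda>(i, j). if i = j \<and> i < k then \<one> else \<zero>)" if "k \<le> p" for k
    using that
  proof (induction k)
    case 0
    then show ?case by (auto simp: w_def intro!: eq_matI)
  next
    case (Suc k)
    have "w (Suc k) = add_mset (U k, V k) (w k)"
      by (simp add: w_def lessThan_Suc)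
    then have "f (ev (w (Suc k))) = U k \<boxdot> V k \<boxplus> f (ev (w k))"
      using UV [of k] by (simp add: \<phi>)
    also have "U k \<boxdot> V k = mat p p (\<lambda>(i, j). if i = k \<and> j = k then \<one> else \<zero>)"
      using Suc.prems q unfolding U_def V_def by (intro mat_units_mult) simp_all
    finally show ?case
      using Suc by (auto intro!: eq_matI)
  qed
  have "ev (w p) = \<one>\<^bsub>S\<^esub>"
    using ev_w [of p] by (intro f_inject) (auto intro!: eq_matI)
  with w show ?thesis
    by (rule tensor_product_iso_regular)
qed

end

theorem proposition19:
  fixes K :: "('a, 'm) kleene_algebra_scheme" and n :: nat
  assumes "kleene_algebra K"
    and "n > 0"
  shows "let M = mat_kleene_algebra n K in
   \<exists>(X :: ('a, 'a mat, 'a mat) bimodule) (Y :: ('a mat, 'a mat, 'a) bimodule).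
    kleene_bimodule K M X \<and> kleene_bimodule M K Y \<and>
    bimodule_iso K K (tensor_product M X Y) (regular_bimodule K) \<and>
    bimodule_iso M M (tensor_product K Y X) (regular_bimodule M)"
proof -
  interpret kleene_algebra K by fact
  have one: "0 < (1 :: nat)" by simp
  note scalar = mat_iso_scalar and square = mat_iso_id [of n]
  show ?thesis
    unfolding Let_def
    using kleene_bimodule_mat [OF scalar square] kleene_bimodule_mat [OF square scalar]
      \<comment> \<open>The positive inner dimension is \<open>n\<close> when tensoring over the
        matrix algebra and 1 when tensoring over \<open>K\<close>.\<close>
      mat_tensor_product_iso_regular [OF scalar square \<open>n > 0\<close>]
      mat_tensor_product_iso_regular [OF square scalar one]
    by blast
qed

end
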